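(* Let $n\ge2$ and let $f:\mathbb{B}^n\to\mathbb{B}^n=f(\mathbb{B}^n)$ be a conformal mapping. Let $x,y\in\mathbb{B}^n$ be distinct and $r_l,r_u,R_l,R_u\in[0,1)$ be such that $|x|,|y|\in[r_l,r_u]$ and $|f(x)|,|f(y)|\in[R_l,R_u]$. Then (1) $\dfrac{1}{1+r_u}\le\dfrac{t_{\mathbb{B}^n}(f(x),f(y))}{t_{\mathbb{B}^n}(x,y)}\le1+R_u$; (2) $\dfrac{2(1+R_l)}{(1+r_u)\sqrt{5+2R_l+R_l^2}}\le\dfrac{j^*_{\mathbb{B}^n}(f(x),f(y))}{j^*_{\mathbb{B}^n}(x,y)}\le\dfrac{(1+R_u)\sqrt{5+2r_l+r_l^2}}{2(1+r_l)}$; (3) $\dfrac{\sqrt{1-2r_u+2r_u^2}\,(1+R_l)}{1+r_u^2}\le\dfrac{p_{\mathbb{B}^n}(f(x),f(y))}{p_{\mathbb{B}^n}(x,y)}\le\dfrac{1+R_u^2}{(1+r_l)\sqrt{1-2R_u+2R_u^2}}$; (4) $\dfrac{\sqrt{1+R_l^2}}{1+r_u}\le\dfrac{b_{\mathbb{B}^n,2}(f(x),f(y))}{b_{\mathbb{B}^n,2}(x,y)}\le\dfrac{1+R_u}{\sqrt{1+r_l^2}}$; (5) $\dfrac{2(1+R_l)\sqrt{1-2r_u+2r_u^2}}{(1+r_u^2)\sqrt{5+2R_l+R_l^2}}\le\dfrac{s_{\mathbb{B}^n}(f(x),f(y))}{s_{\mathbb{B}^n}(x,y)}\le\dfrac{(1+R_u^2)\sqrt{5+2r_l+r_l^2}}{2(1+r_l)\sqrt{1-2R_u+2R_u^2}}$;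 (6) the same bounds as in (5) hold for $\dfrac{w_{\mathbb{B}^n}(f(x),f(y))}{w_{\mathbb{B}^n}(x,y)}$.
   Context: $\mathbb{B}^n$ is the unit ball; $S^{n-1}(x,r)$ is the Euclidean sphere of center $x$ and radius $r$. For a domain $G\subsetneq\mathbb{R}^n$ and $x\in G$, $d_G(x)=\inf\{|x-z|:z\in\partial G\}$. Intrinsic (quasi-)metrics: $t_G(x,y)=\frac{|x-y|}{|x-y|+d_G(x)+d_G(y)}$; $j^*_G(x,y)=\frac{|x-y|}{|x-y|+2\min\{d_G(x),d_G(y)\}}$; $s_G(x,y)=\frac{|x-y|}{\inf_{z\in\partial G}(|x-z|+|z-y|)}$; $p_G(x,y)=\frac{|x-y|}{\sqrt{|x-y|^2+4d_G(x)d_G(y)}}$; $b_{G,p}(x,y)=\sup_{z\in\partial G}\frac{|x-y|}{(|x-z|^p+|z-y|^p)^{1/p}}$ ($p\ge1$); for convex $G$, $w_G(x,y)=\frac{|x-y|}{\min\{\inf_{\tilde y\in\tilde Y}|x-\tilde y|,\ \inf_{\tilde x\in\tilde X}|y-\tilde x|\}}$ with $\tilde X=\{\tilde x\in S^{n-1}(x,2d_G(x)):(x+\tilde x)/2\in\partial G\}$, $\tilde Y=\{\tilde y\in S^{n-1}(y,2d_G(y)):(y+\tilde y)/2\in\partial G\}$. A conformal mapping is a homeomorphism $f$ with continuous derivative, nonvanishing Jacobian, and $|f'(x)h|=|f'(x)||h|$ for all $x,h$. *)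

theory Defs
  imports "HOL-Analysis.Analysis"
begin

definition dG :: "(real^'n) set \<Rightarrow> real^'n \<Rightarrow> real" where
  "dG G x = (INF z\<in>frontier G. dist x z)"

definition t_metric :: "(real^'n) set \<Rightarrow> real^'n \<Rightarrow> real^'n \<Rightarrow> real" where
  "t_metric G x y = dist x y / (dist x y + dG G x + dG G y)"

definition jstar_metric :: "(real^'n) set \<Rightarrow> real^'n \<Rightarrow> real^'n \<Rightarrow> real" where
  "jstar_metric G x y = dist x y / (dist x y + 2 * min (dG G x) (dG G y))"

definition s_metric :: "(real^'n) set \<Rightarrow> real^'n \<Rightarrow> real^'n \<Rightarrow> real" where
  "s_metric G x y = dist x y / (INF z\<in>frontier G. dist x z + dist z y)"

definition p_metric :: "(real^'n) set \<Rightarrow> real^'n \<Rightarrow> real^'n \<Rightarrow> real" where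
  "p_metric G x y = dist x y / sqrt ((dist x y)\<^sup>2 + 4 * dG G x * dG G y)"

text \<open>Barrlund metric b_{G,p}, for p >= 1.\<close>
definition b_metric :: "(real^'n) set \<Rightarrow> real \<Rightarrow> real^'n \<Rightarrow> real^'n \<Rightarrow> real" where
  "b_metric G p x y =
     (SUP z\<in>frontier G. dist x y / ((dist x z powr p + dist z y powr p) powr (1 / p)))"

text \<open>The point pair function w_G (for convex G).\<close>
definition w_Xt :: "(real^'n) set \<Rightarrow> real^'n \<Rightarrow> (real^'n) set" where
  "w_Xt G x = {xt \<in> sphere x (2 * dG G x). (x + xt) /\<^sub>R 2 \<in> frontier G}"

definition w_metric :: "(real^'n) set \<Rightarrow> real^'n \<Rightarrow> real^'n \<Rightarrow> real" where
  "w_metric G x y = dist x y /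
     min (INF yt\<in>w_Xt G y. dist x yt) (INF xt\<in>w_Xt G x. dist y xt)"

definition conformal_map :: "(real^'n) set \<Rightarrow> (real^'n) set \<Rightarrow> (real^'n \<Rightarrow> real^'n) \<Rightarrow> bool" where
  "conformal_map S T f \<longleftrightarrow>
     (\<exists>g. homeomorphism S T f g) \<and>
     (\<exists>f'. (\<forall>x\<in>S. (f has_derivative f' x) (at x)) \<and>
          continuous_on S (\<lambda>x. matrix (f' x)) \<and>
          (\<forall>x\<in>S. det (matrix (f' x)) \<noteq> 0) \<and>
          (\<forall>x\<in>S. \<forall>h. norm (f' x h) = onorm (f' x) * norm h))"

end

theory Submission
  imports Defs
begin

text \<open>
  A conformal self-map of the ball is a hyperbolic isometry. No Liouville theorem is needed for this:
  by composing with inversions in spheres orthogonal to the unit sphere it suffices to prove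
  \<open>|f'(0)| \<ge> 1\<close> whenever \<open>f 0 = 0\<close>, and then to apply this also to the inverse map. This is a
  length-area argument for the function \<open>- ln |f|\<close> on the ring \<open>\<epsilon> < |x| < 1\<close>: the change of variables formula
  bounds its \<open>n\<close>-energy by the measure of the image ring with respect to \<open>dz / |z|\<^sup>n\<close>,
  and its increase along rays bounds the energy from below; as \<open>\<epsilon>\<close> tends to 0 this is
  contradictory if \<open>n \<ge> 2\<close> and \<open>|f'(0)| < 1\<close>.

  Each of the six metrics is bounded on both sides by explicit multiples of the invariant
  \<open>|x - y| / A\<close> with \<open>A\<^sup>2 = |x - y|\<^sup>2 + (1 - |x|\<^sup>2) (1 - |y|\<^sup>2)\<close>, and the theorem follows by taking quotients.
  For \<open>s\<close> and \<open>w\<close> the multiples are those for \<open>j\<^sup>*\<close> and \<open>p\<close>, which lie below and above them.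
\<close>

section \<open>Conformal self-maps of the unit ball\<close>

text \<open>Let \<open>M\<close> be the logarithmic width of the ring and
  \<open>L 0 = exp (- l)\<close>. Along a ray \<open>- ln |f|\<close> grows by about
  \<open>M + l\<close>, and the image ring has logarithmic width about \<open>M + l\<close> too.
  Averaged over rays, \<open>n q <= q ^ n + (n - 1)\<close> therefore gives
  \<open>n (M + l) <= (M + l) + (n - 1) M\<close>, that is \<open>(n - 1) l <= 0\<close>. Since this
  inequality is linear, the errors do not grow with \<open>M\<close>, so one ring with a small
  enough hole suffices. Averaging over rays means integrating along dilation orbits started in a
  thin shell, which replaces polar coordinates. The lower bound for \<open>|f'(0)|\<close>, used for
  \<open>f\<close> and its inverse at every point, says that \<open>f\<close> preserves the density
  \<open>1 / (1 - |x|^2)\<close>; integrating it along radii yields the two-point invariant.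
  \<open>ball_conf\<close> carries the inverse and the dilation \<open>L x = |f'(x)|\<close>
  explicitly, so that both are known for compositions and inverses. It fixes no orientation, so
  inversions qualify.\<close>

definition ball_conf :: "('a::euclidean_space \<Rightarrow> 'a) \<Rightarrow> ('a \<Rightarrow> 'a) \<Rightarrow> ('a \<Rightarrow> real) \<Rightarrow> bool" where
  "ball_conf f g L \<longleftrightarrow>
     homeomorphism (ball 0 1) (ball 0 1) f g \<and> continuous_on (ball 0 1) L \<and>
     (\<forall>x\<in>ball 0 1. 0 < L x \<and> (\<exists>f'. (f has_derivative f') (at x) \<and> (\<forall>h. norm (f' h) = L x * norm h)))"

lemma ball_confD:
  assumes "ball_conf f g L"
  shows "norm x < 1 \<Longrightarrow> norm (f x) < 1" "norm x < 1 \<Longrightarrow> norm (g x) < 1"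
    "norm x < 1 \<Longrightarrow> g (f x) = x" "norm x < 1 \<Longrightarrow> f (g x) = x" "norm x < 1 \<Longrightarrow> 0 < L x"
    "f ` ball 0 1 = ball 0 1" "g ` ball 0 1 = ball 0 1"
    "continuous_on (ball 0 1) f" "continuous_on (ball 0 1) g" "continuous_on (ball 0 1) L"
  using assms unfolding ball_conf_def homeomorphism_def by (blast intro: mem_ball_0[THEN iffD1] mem_ball_0[THEN iffD2])+

lemma ball_conf_derivative:
  assumes "ball_conf f g L" "norm x < 1"
  obtains f' where "(f has_derivative f') (at x)" "\<And>h. norm (f' h) = L x * norm h"
  using assms unfolding ball_conf_def by (meson mem_ball_0)

text \<open>A linear map that scales all lengths by a positive factor is injective, hence invertible
  in finite dimension. As \<open>g\<close> is continuous, the inverse of this derivative is the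
  derivative of \<open>g\<close>.\<close>

lemma ball_conf_inverse:
  assumes c: "ball_conf f g L"
  shows "ball_conf g f (\<lambda>y. inverse (L (g y)))"
  unfolding ball_conf_def
proof (intro conjI ballI)
  show "homeomorphism (ball 0 1) (ball 0 1) g f"
    using c homeomorphism_symD ball_conf_def by blast
  show "continuous_on (ball 0 1) (\<lambda>y. inverse (L (g y)))"
  proof (intro continuous_on_inverse ballI)
    show "continuous_on (ball 0 1) (\<lambda>y. L (g y))"
      using continuous_on_compose2[OF ball_confD(10)[OF c] ball_confD(9)[OF c]] ball_confD(7)[OF c] by blast
    show "L (g y) \<noteq> 0" if "y \<in> ball 0 1" for y
      using ball_confD(2,5)[OF c] that by (metis less_irrefl mem_ball_0)
  qed
next
  fix y :: 'a assume "y \<in> ball 0 1"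
  then have y: "norm y < 1" by simp
  then have gy: "norm (g y) < 1" using ball_confD(2)[OF c] by blast
  then show "0 < inverse (L (g y))" using ball_confD(5)[OF c] by simp
  from gy obtain f' where f': "(f has_derivative f') (at (g y))" and nf: "\<And>h. norm (f' h) = L (g y) * norm h"
    by (rule ball_conf_derivative[OF c]) blast
  have Lp: "L (g y) > 0" using ball_confD(5)[OF c gy] .
  have lin: "linear f'" using f' has_derivative_linear by blast
  have "inj f'"
    by (rule linear_injective_0[OF lin, THEN iffD2]) (use nf Lp in \<open>metis mult_eq_0_iff norm_eq_zero less_irrefl\<close>)
  then obtain g' where g': "linear g'" "\<And>x. g' (f' x) = x" "\<And>x. f' (g' x) = x"
    using linear_injective_isomorphism[OF lin] by blast
  have "(g has_derivative g') (at y)"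
  proof (rule has_derivative_inverse_basic[where f=f and g=g and y=y, OF f', where T="ball 0 1"])
    show "bounded_linear g'" using g' linear_conv_bounded_linear by blast
    show "g' \<circ> f' = id" using g' by auto
    show "continuous (at y) g" using ball_confD(9)[OF c] y by (simp add: continuous_on_eq_continuous_at)
    show "\<And>z. z \<in> ball 0 1 \<Longrightarrow> f (g z) = z" using ball_confD(4)[OF c] by simp
  qed (use y in auto)
  moreover have "norm (g' h) = inverse (L (g y)) * norm h" for h
    using nf[of "g' h"] g'(3)[of h] Lp by (simp add: field_simps)
  ultimately show "\<exists>g'. (g has_derivative g') (at y) \<and> (\<forall>h. norm (g' h) = inverse (L (g y)) * norm h)"
    by blast
qed

lemma ball_conf_compose:
  assumes c1: "ball_conf f1 g1 L1" and c2: "ball_conf f2 g2 L2"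
  shows "ball_conf (f2 \<circ> f1) (g1 \<circ> g2) (\<lambda>x. L2 (f1 x) * L1 x)"
  unfolding ball_conf_def
proof (intro conjI ballI)
  show "homeomorphism (ball 0 1) (ball 0 1) (f2 \<circ> f1) (g1 \<circ> g2)"
    using c1 c2 homeomorphism_compose ball_conf_def by blast
  show "continuous_on (ball 0 1) (\<lambda>x. L2 (f1 x) * L1 x)"
    using continuous_on_compose2[OF ball_confD(10)[OF c2] ball_confD(8)[OF c1]] ball_confD(6)[OF c1]
    by (intro continuous_intros ball_confD(10)[OF c1]) blast
next
  fix x :: 'a assume "x \<in> ball 0 1"
  then have x: "norm x < 1" by simp
  then have fx: "norm (f1 x) < 1" using ball_confD(1)[OF c1] by blast
  show "0 < L2 (f1 x) * L1 x" using ball_confD(5)[OF c1 x] ball_confD(5)[OF c2 fx] by simp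
  obtain f1' where 1: "(f1 has_derivative f1') (at x)" "\<And>h. norm (f1' h) = L1 x * norm h"
    using ball_conf_derivative[OF c1 x] by blast
  obtain f2' where 2: "(f2 has_derivative f2') (at (f1 x))" "\<And>h. norm (f2' h) = L2 (f1 x) * norm h"
    using ball_conf_derivative[OF c2 fx] by blast
  have "(f2 \<circ> f1 has_derivative f2' \<circ> f1') (at x)"
    using 1(1) 2(1) by (rule diff_chain_at)
  then show "\<exists>f'. (f2 \<circ> f1 has_derivative f') (at x) \<and> (\<forall>h. norm (f' h) = L2 (f1 x) * L1 x * norm h)"
    using 1(2) 2(2) by (intro exI[of _ "f2' \<circ> f1'"]) (simp add: mult.assoc)
qed

lemma ball_conf_id: "ball_conf id id (\<lambda>_. 1)"
  unfolding ball_conf_def id_def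
  by (auto simp: homeomorphism_def intro!: exI[of _ "\<lambda>x. x"] has_derivative_ident)

lemma conformal_map_imp_ball_conf:
  fixes f :: "real^'n \<Rightarrow> real^'n"
  assumes "conformal_map (ball 0 1) (ball 0 1) f"
  obtains g L where "ball_conf f g L"
proof -
  obtain g where g: "homeomorphism (ball 0 1) (ball 0 1) f g"
    using assms unfolding conformal_map_def by blast
  from assms obtain f' where F: "\<forall>x\<in>ball 0 1. (f has_derivative f' x) (at x)"
      "continuous_on (ball 0 1) (\<lambda>x. matrix (f' x))" "\<forall>x\<in>ball 0 1. det (matrix (f' x)) \<noteq> 0"
      "\<forall>x\<in>ball 0 1. \<forall>h. norm (f' x h) = onorm (f' x) * norm h"
    unfolding conformal_map_def by (elim conjE exE)
  note f' = F(1)[rule_format] and cont = F(2) and det = F(3)[rule_format] and conf = F(4)[rule_format]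
  \<comment> \<open>By conformality \<open>onorm (f' x)\<close> is the length of the image of any
    one unit vector. A fixed one exhibits the dilation as a continuous function of the matrix, and
    as positive because the matrix is invertible.\<close>
  let ?e = "axis undefined (1::real) :: real^'n"
  have e: "norm ?e = 1" by simp
  have L: "onorm (f' x) = norm (matrix (f' x) *v ?e)" if "x \<in> ball 0 1" for x
  proof -
    have "matrix (f' x) *v ?e = f' x ?e"
      by (rule matrix_works[OF linear_matrix_vector_mul_eq[THEN iffD2, OF has_derivative_linear[OF f'[OF that]]]])
    then show ?thesis using conf[OF that, of ?e] e by simp
  qed
  have "ball_conf f g (\<lambda>x. onorm (f' x))"
    unfolding ball_conf_def
  proof (intro conjI ballI)
    have "continuous_on (ball 0 1) (\<lambda>x. norm (matrix (f' x) *v ?e))"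
      unfolding matrix_vector_mult_def
      by (intro continuous_intros continuous_on_component cont)
    then show "continuous_on (ball 0 1) (\<lambda>x. onorm (f' x))"
      by (rule continuous_on_eq) (use L in auto)
  next
    fix x :: "real^'n" assume x: "x \<in> ball 0 1"
    have "matrix (f' x) *v ?e \<noteq> 0"
    proof
      assume "matrix (f' x) *v ?e = 0"
      moreover have "invertible (matrix (f' x))" using det[OF x] by (simp add: invertible_det_nz)
      then obtain B where "B ** matrix (f' x) = mat 1" unfolding invertible_def by blast
      then have "B *v (matrix (f' x) *v ?e) = ?e" by (simp add: matrix_vector_mul_assoc)
      ultimately show False using e by simp
    qed
    then show "0 < onorm (f' x)" using L[OF x] by simp
    show "\<exists>F. (f has_derivative F) (at x) \<and> (\<forall>h. norm (F h) = onorm (f' x) * norm h)"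
      using f'[OF x] conf[OF x] by blast
  qed (rule g)
  then show thesis using that by blast
qed

text \<open>Inversion in the sphere orthogonal to the unit sphere with centre \<open>c = a / |a|\<^sup>2\<close>; it swaps \<open>a\<close> and \<open>0\<close>.\<close>
definition sph_inv :: "'a::euclidean_space \<Rightarrow> 'a \<Rightarrow> 'a" where
  "sph_inv c x = c + ((norm c ^ 2 - 1) / (norm (x - c))\<^sup>2) *\<^sub>R (x - c)"

lemma sph_inv_invol:
  assumes "norm c > 1" "norm x < 1"
  shows "sph_inv c (sph_inv c x) = x"
proof -
  have xc: "x \<noteq> c" using assms by auto
  have p: "norm c ^ 2 - 1 > 0" using assms by (simp add: one_less_power)
  define k where "k = (norm c ^ 2 - 1) / (norm (x - c))\<^sup>2"
  have k: "k > 0" using p xc by (simp add: k_def)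
  have "sph_inv c x - c = k *\<^sub>R (x - c)" by (simp add: sph_inv_def k_def)
  then have "sph_inv c (sph_inv c x) = c + ((norm c ^ 2 - 1) / (k * norm (x - c))\<^sup>2 * k) *\<^sub>R (x - c)"
    using k by (subst sph_inv_def) (simp add: abs_of_pos)
  also have "(norm c ^ 2 - 1) / (k * norm (x - c))\<^sup>2 * k = 1"
  proof -
    have "(norm c ^ 2 - 1) = k * (norm (x - c))\<^sup>2" using xc by (simp add: k_def)
    then show ?thesis using k xc by (simp add: power2_eq_square)
  qed
  finally show ?thesis by simp
qed

text \<open>The factor in front is also the dilation of the inversion at \<open>x\<close>. The
  identity thus shows both that the ball is mapped into itself and that the dilation is a quotient
  of values of \<open>1 - |.|^2\<close>.\<close>

lemma sph_inv_norm:
  assumes "norm c > 1" "norm x < 1"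
  shows "1 - (norm (sph_inv c x))\<^sup>2 = (norm c ^ 2 - 1) / (norm (x - c))\<^sup>2 * (1 - (norm x)\<^sup>2)"
proof -
  have xc: "x \<noteq> c" using assms by auto
  define k where "k = (norm c ^ 2 - 1) / (norm (x - c))\<^sup>2"
  have k: "k * (norm (x - c))\<^sup>2 = norm c ^ 2 - 1" using xc by (simp add: k_def)
  have "(norm (c + k *\<^sub>R X))\<^sup>2 = norm c ^ 2 + 2 * k * (c \<bullet> X) + k * (k * (norm X)\<^sup>2)" for X :: 'a
    unfolding power2_norm_eq_inner
    by (simp add: inner_add_left inner_add_right inner_commute algebra_simps)
  from this[of "x - c"] have "(norm (sph_inv c x))\<^sup>2 = norm c ^ 2 + 2 * k * (c \<bullet> (x - c)) + k * (k * (norm (x - c))\<^sup>2)"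
    unfolding sph_inv_def k_def .
  also have "\<dots> = norm c ^ 2 + 2 * k * (c \<bullet> (x - c)) + k * (norm c ^ 2 - 1)" by (simp only: k)
  finally have 1: "(norm (sph_inv c x))\<^sup>2 = norm c ^ 2 + 2 * k * (c \<bullet> (x - c)) + k * (norm c ^ 2 - 1)" .
  have 2: "(norm (x - c))\<^sup>2 = (norm x)\<^sup>2 - (norm c)\<^sup>2 - 2 * (c \<bullet> (x - c))"
    unfolding power2_norm_eq_inner by (simp add: inner_diff_left inner_diff_right inner_commute)
  have "1 - (norm (sph_inv c x))\<^sup>2 = - (k * (norm (x - c))\<^sup>2) - 2 * k * (c \<bullet> (x - c)) - k * (norm c ^ 2 - 1)"
    unfolding 1 k by simp
  also have "\<dots> = k * (1 - (norm x)\<^sup>2)"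
    unfolding 2 by (simp add: algebra_simps)
  finally show ?thesis unfolding k_def .
qed

lemma sph_inv_dist:
  assumes "norm c > 1" "norm x < 1" "norm y < 1"
  shows "dist (sph_inv c x) (sph_inv c y) = (norm c ^ 2 - 1) / (norm (x - c) * norm (y - c)) * dist x y"
proof -
  define X where "X = x - c"
  define Y where "Y = y - c"
  have XY: "X \<noteq> 0" "Y \<noteq> 0" using assms by (auto simp: X_def Y_def)
  have p: "norm c ^ 2 - 1 > 0" using assms by (simp add: one_less_power)
  define r where "r = norm c ^ 2 - 1"
  have XX: "X \<bullet> X = (norm X)\<^sup>2" "Y \<bullet> Y = (norm Y)\<^sup>2" by (simp_all add: power2_norm_eq_inner)
  have "(dist (sph_inv c x) (sph_inv c y))\<^sup>2 = (norm ((r / (norm X)\<^sup>2) *\<^sub>R X - (r / (norm Y)\<^sup>2) *\<^sub>R Y))\<^sup>2"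
    by (simp add: dist_norm sph_inv_def X_def Y_def r_def)
  also have "\<dots> = (r / (norm X)\<^sup>2)^2 * (norm X)\<^sup>2 - 2 * (r / (norm X)\<^sup>2) * (r / (norm Y)\<^sup>2) * (X \<bullet> Y) + (r / (norm Y)\<^sup>2)^2 * (norm Y)\<^sup>2"
    unfolding power2_norm_eq_inner[of "_ - _"]
    by (simp add: inner_diff_left inner_diff_right inner_commute XX power2_eq_square)
  also have "\<dots> = (r / (norm X * norm Y))\<^sup>2 * ((norm X)\<^sup>2 - 2 * (X \<bullet> Y) + (norm Y)\<^sup>2)"
    using XY by (simp add: field_simps power2_eq_square)
  also have "(norm X)\<^sup>2 - 2 * (X \<bullet> Y) + (norm Y)\<^sup>2 = (norm (X - Y))\<^sup>2"
    unfolding power2_norm_eq_inner by (simp add: inner_diff_left inner_diff_right inner_commute)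
  also have "X - Y = x - y" by (simp add: X_def Y_def)
  finally have "(dist (sph_inv c x) (sph_inv c y))\<^sup>2 = (r / (norm X * norm Y) * dist x y)\<^sup>2"
    by (simp only: dist_norm power_mult_distrib)
  then have "dist (sph_inv c x) (sph_inv c y) = r / (norm X * norm Y) * dist x y"
    by (rule power2_eq_imp_eq) (use p in \<open>auto simp: r_def\<close>)
  then show ?thesis by (simp add: r_def X_def Y_def)
qed

text \<open>The two-point formula determines the norm of the derivative, without computing the latter.\<close>
lemma norm_derivative_from_dist:
  fixes f :: "'a::real_normed_vector \<Rightarrow> 'b::real_normed_vector"
  assumes f': "(f has_derivative f') (at x)" and "open S" "x \<in> S"
    and d: "\<And>y. y \<in> S \<Longrightarrow> dist (f y) (f x) = K y * dist y x" and K: "isCont K x"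
  shows "norm (f' h) = K x * norm h"
proof -
  have seq: "(\<lambda>t::real. x + t *\<^sub>R h) \<midarrow>0\<rightarrow> x" by (auto intro!: tendsto_eq_intros)
  have ev: "\<forall>\<^sub>F t in at (0::real). x + t *\<^sub>R h \<in> S"
    using seq \<open>open S\<close> \<open>x \<in> S\<close> by (rule topological_tendstoD)
  have "((\<lambda>t::real. f (x + t *\<^sub>R h)) has_derivative (\<lambda>t. t *\<^sub>R f' h)) (at 0)"
  proof -
    have "((\<lambda>t::real. x + t *\<^sub>R h) has_derivative (\<lambda>t. t *\<^sub>R h)) (at 0)"
      by (auto intro!: derivative_eq_intros)
    moreover have "(f has_derivative f') (at (x + 0 *\<^sub>R h))" using f' by simp
    ultimately have "((\<lambda>t::real. f (x + t *\<^sub>R h)) has_derivative (\<lambda>t. f' (t *\<^sub>R h))) (at 0)"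
      by (rule has_derivative_compose)
    moreover have "f' (t *\<^sub>R h) = t *\<^sub>R f' h" for t
      using f' has_derivative_linear linear_cmul by blast
    ultimately show ?thesis by simp
  qed
  then have "(\<lambda>t. norm (f (x + t *\<^sub>R h) - f x - t *\<^sub>R f' h) / norm t) \<midarrow>0\<rightarrow> 0"
    by (simp add: has_derivative_at)
  moreover have "\<forall>\<^sub>F t in at (0::real). norm (f (x + t *\<^sub>R h) - f x - t *\<^sub>R f' h) / norm t
      = norm ((f (x + t *\<^sub>R h) - f x) /\<^sub>R t - f' h)"
    unfolding eventually_at_filter
  proof (intro always_eventually allI impI)
    fix t :: real assume t: "t \<noteq> 0"
    have "f (x + t *\<^sub>R h) - f x - t *\<^sub>R f' h = t *\<^sub>R ((f (x + t *\<^sub>R h) - f x) /\<^sub>R t - f' h)"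
      using t by (simp add: scaleR_diff_right)
    then show "norm (f (x + t *\<^sub>R h) - f x - t *\<^sub>R f' h) / norm t = norm ((f (x + t *\<^sub>R h) - f x) /\<^sub>R t - f' h)"
      using t by simp
  qed
  ultimately have "(\<lambda>t. norm ((f (x + t *\<^sub>R h) - f x) /\<^sub>R t - f' h)) \<midarrow>0\<rightarrow> 0"
    by (rule Lim_transform_eventually)
  then have "(\<lambda>t. (f (x + t *\<^sub>R h) - f x) /\<^sub>R t) \<midarrow>0\<rightarrow> f' h"
    by (rule LIM_zero_cancel[OF tendsto_norm_zero_cancel])
  then have 1: "(\<lambda>t. norm ((f (x + t *\<^sub>R h) - f x) /\<^sub>R t)) \<midarrow>0\<rightarrow> norm (f' h)" by (rule tendsto_norm)
  have 2: "(\<lambda>t::real. K (x + t *\<^sub>R h) * norm h) \<midarrow>0\<rightarrow> K x * norm h"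
    by (intro tendsto_intros isCont_tendsto_compose[OF K seq])
  have "\<forall>\<^sub>F t in at (0::real). norm ((f (x + t *\<^sub>R h) - f x) /\<^sub>R t) = K (x + t *\<^sub>R h) * norm h"
    using ev eventually_neq_at_within[of 0 0 UNIV]
  proof eventually_elim
    case (elim t)
    have "norm (f (x + t *\<^sub>R h) - f x) = K (x + t *\<^sub>R h) * (\<bar>t\<bar> * norm h)"
      using d[OF elim(1)] by (simp add: dist_norm)
    then show ?case unfolding norm_scaleR using elim(2) by simp
  qed
  with 1 have "(\<lambda>t::real. K (x + t *\<^sub>R h) * norm h) \<midarrow>0\<rightarrow> norm (f' h)"
    by (rule Lim_transform_eventually)
  with 2 show ?thesis using LIM_unique by blast
qed

lemma sph_inv_ball_conf:
  assumes c: "norm c > 1"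
  shows "ball_conf (sph_inv c) (sph_inv c) (\<lambda>x. (1 - (norm (sph_inv c x))\<^sup>2) / (1 - (norm x)\<^sup>2))"
proof -
  have p: "norm c ^ 2 - 1 > 0" using assms by (simp add: one_less_power)
  have ne: "x \<noteq> c" if "norm x < 1" for x using that c by auto
  have sq: "(norm x)\<^sup>2 < 1" if "norm x < 1" for x :: 'a
    using that by (simp add: power_less_one_iff)
  have L: "(1 - (norm (sph_inv c x))\<^sup>2) / (1 - (norm x)\<^sup>2) = (norm c ^ 2 - 1) / (norm (x - c))\<^sup>2"
    if "norm x < 1" for x
    using sph_inv_norm[OF c that] sq[OF that] by simp
  have into: "norm (sph_inv c x) < 1" if "norm x < 1" for x
  proof -
    have "1 - (norm (sph_inv c x))\<^sup>2 > 0"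
      unfolding sph_inv_norm[OF c that] using p ne[OF that] sq[OF that] by simp
    then show ?thesis by (simp add: power_less_one_iff)
  qed
  have der: "\<exists>f'. (sph_inv c has_derivative f') (at x)" if "norm x < 1" for x
  proof -
    have "(\<lambda>x. c + ((norm c ^ 2 - 1) / ((x - c) \<bullet> (x - c))) *\<^sub>R (x - c)) differentiable at x"
      using ne[OF that] by (auto intro!: derivative_intros)
    then show ?thesis
      unfolding differentiable_def sph_inv_def[abs_def] power2_norm_eq_inner .
  qed
  have cont: "continuous_on (ball 0 1) (sph_inv c)"
    using der by (meson continuous_at_imp_continuous_on has_derivative_continuous mem_ball_0)
  show ?thesis
    unfolding ball_conf_def
  proof (intro conjI ballI)
    show "homeomorphism (ball 0 1) (ball 0 1) (sph_inv c) (sph_inv c)"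
      using cont into sph_inv_invol[OF c] by (intro homeomorphismI) auto
    show "continuous_on (ball 0 1) (\<lambda>x. (1 - (norm (sph_inv c x))\<^sup>2) / (1 - (norm x)\<^sup>2))"
      using sq by (intro continuous_intros cont) force
  next
    fix x :: 'a assume "x \<in> ball 0 1"
    then have x: "norm x < 1" by simp
    show "0 < (1 - (norm (sph_inv c x))\<^sup>2) / (1 - (norm x)\<^sup>2)"
      using sq[OF x] sq[OF into[OF x]] by simp
    obtain f' where f': "(sph_inv c has_derivative f') (at x)" using der[OF x] by blast
    \<comment> \<open>In the two-point formula one point stays at \<open>x\<close>, so the quotient
      \<open>K\<close> depends on the other point alone; at \<open>x\<close> it becomes the
      dilation.\<close>
    have "norm (f' h) = (norm c ^ 2 - 1) / (norm (x - c) * norm (x - c)) * norm h" for h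
    proof (rule norm_derivative_from_dist[OF f', where S="ball 0 1" and K="\<lambda>y. (norm c ^ 2 - 1) / (norm (y - c) * norm (x - c))"])
      show "isCont (\<lambda>y. (norm c ^ 2 - 1) / (norm (y - c) * norm (x - c))) x"
        using ne[OF x] by (intro continuous_intros) auto
    qed (use x sph_inv_dist[OF c _ x] in auto)
    then show "\<exists>f'. (sph_inv c has_derivative f') (at x) \<and> (\<forall>h. norm (f' h) = (1 - (norm (sph_inv c x))\<^sup>2) / (1 - (norm x)\<^sup>2) * norm h)"
      using f' unfolding L[OF x] by (auto simp: power2_eq_square)
  qed
qed

text \<open>The squared distance gains the factors of both points, and these are exactly the factors
  gained by the two terms of the denominator.\<close>

lemma sph_inv_hyperbolic:
  assumes "norm c > 1" "norm x < 1" "norm y < 1"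
  shows "(dist (sph_inv c x) (sph_inv c y))\<^sup>2 / ((1 - (norm (sph_inv c x))\<^sup>2) * (1 - (norm (sph_inv c y))\<^sup>2))
    = (dist x y)\<^sup>2 / ((1 - (norm x)\<^sup>2) * (1 - (norm y)\<^sup>2))"
proof -
  have p: "norm c ^ 2 - 1 > 0" using assms by (simp add: one_less_power)
  have ne: "norm (x - c) > 0" "norm (y - c) > 0" using assms by auto
  have sq: "1 - (norm x)\<^sup>2 > 0" "1 - (norm y)\<^sup>2 > 0" using assms by (simp_all add: power_less_one_iff)
  show ?thesis
    unfolding sph_inv_norm[OF assms(1,2)] sph_inv_norm[OF assms(1,3)] sph_inv_dist[OF assms]
    using p ne sq by (simp add: power_mult_distrib power_divide divide_simps) (simp add: power2_eq_square)
qed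

lemma sph_inv_center:
  assumes "a \<noteq> 0" "norm a < 1"
  defines "c \<equiv> a /\<^sub>R (norm a)\<^sup>2"
  shows "norm c > 1" "sph_inv c a = 0" "sph_inv c 0 = a"
proof -
  define n where "n = norm a"
  have n: "0 < n" "n < 1" using assms by (auto simp: n_def)
  have nc: "norm c = 1 / n" using n by (simp add: c_def n_def[symmetric] power2_eq_square divide_simps)
  show 1: "norm c > 1" using nc n by simp
  have "sph_inv c 0 = (1 - (norm c ^ 2 - 1) / (norm c)\<^sup>2) *\<^sub>R c"
    by (simp add: sph_inv_def scaleR_diff_left)
  also have "1 - (norm c ^ 2 - 1) / (norm c)\<^sup>2 = n\<^sup>2"
    unfolding nc using n by (simp add: field_simps)
  also have "n\<^sup>2 *\<^sub>R c = a" using n by (simp add: c_def n_def)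
  finally show 2: "sph_inv c 0 = a" .
  show "sph_inv c a = 0" using sph_inv_invol[OF 1, of 0] 2 by simp
qed

section \<open>The dilation-invariant measure\<close>

text \<open>In the coordinates \<open>- ln |x|\<close> and \<open>x / |x|\<close> this is Lebesgue
  measure times surface measure. At the origin the density is \<open>1 / 0 = 0\<close>.\<close>

definition dil_measure :: "'a::euclidean_space measure" where
  "dil_measure = density lborel (\<lambda>x. ennreal (1 / norm x ^ DIM('a)))"

lemma sets_dil_measure [measurable_cong, simp]: "sets dil_measure = sets borel"
  by (simp add: dil_measure_def)

lemma space_dil_measure [simp]: "space dil_measure = UNIV"
  by (simp add: dil_measure_def)

lemma nn_integral_dil_measure:
  fixes h :: "'a::euclidean_space \<Rightarrow> ennreal"
  assumes "h \<in> borel_measurable borel"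
  shows "(\<integral>\<^sup>+x. h x \<partial>dil_measure) = (\<integral>\<^sup>+x. ennreal (1 / norm x ^ DIM('a)) * h x \<partial>lborel)"
  unfolding dil_measure_def using assms by (intro nn_integral_density) auto

lemma emeasure_dil_measure:
  fixes A :: "'a::euclidean_space set"
  assumes "A \<in> sets borel"
  shows "emeasure dil_measure A = (\<integral>\<^sup>+x\<in>A. ennreal (1 / norm x ^ DIM('a)) \<partial>lborel)"
  unfolding dil_measure_def using assms by (intro emeasure_density) auto

text \<open>The Jacobian \<open>c ^ n\<close> of the dilation cancels against the change of the
  density.\<close>

lemma nn_integral_dil_measure_scale:
  fixes h :: "'a::euclidean_space \<Rightarrow> ennreal"
  assumes [measurable]: "h \<in> borel_measurable borel" and c: "0 < c"
  shows "(\<integral>\<^sup>+x. h (c *\<^sub>R x) \<partial>dil_measure) = (\<integral>\<^sup>+x. h x \<partial>dil_measure)"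
proof -
  have "(\<integral>\<^sup>+x. h x \<partial>dil_measure) = (\<integral>\<^sup>+x. ennreal (1 / norm x ^ DIM('a)) * h x \<partial>lborel)"
    by (rule nn_integral_dil_measure) simp
  also have "\<dots> = (\<integral>\<^sup>+x. ennreal (1 / norm x ^ DIM('a)) * h x
      \<partial>density (distr lborel borel (\<lambda>x. 0 + c *\<^sub>R x)) (\<lambda>_. ennreal (\<bar>c\<bar>^DIM('a))))"
    using lborel_affine[of c "0::'a"] c by simp
  also have "\<dots> = (\<integral>\<^sup>+x. ennreal (\<bar>c\<bar>^DIM('a)) * (ennreal (1 / norm (c *\<^sub>R x) ^ DIM('a)) * h (c *\<^sub>R x)) \<partial>lborel)"
    by (simp add: nn_integral_density nn_integral_distr)
  also have "\<dots> = (\<integral>\<^sup>+x. ennreal (1 / norm x ^ DIM('a)) * h (c *\<^sub>R x) \<partial>lborel)"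
  proof (rule nn_integral_cong)
    fix x :: 'a
    have "\<bar>c\<bar>^DIM('a) * (1 / norm (c *\<^sub>R x) ^ DIM('a)) = 1 / norm x ^ DIM('a)"
      using c by (simp add: power_mult_distrib)
    then show "ennreal (\<bar>c\<bar>^DIM('a)) * (ennreal (1 / norm (c *\<^sub>R x) ^ DIM('a)) * h (c *\<^sub>R x))
        = ennreal (1 / norm x ^ DIM('a)) * h (c *\<^sub>R x)"
      by (simp add: mult.assoc[symmetric] ennreal_mult[symmetric])
  qed
  also have "\<dots> = (\<integral>\<^sup>+x. h (c *\<^sub>R x) \<partial>dil_measure)"
    by (rule nn_integral_dil_measure[symmetric]) simp
  finally show ?thesis by simp
qed

text \<open>For \<open>x\<close> different from 0 the condition is
  \<open>s \<le> - ln |x| < t\<close>, so dilations translate the parameters. The interval is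
  half-open so that consecutive shells fit together.\<close>

definition shell :: "real \<Rightarrow> real \<Rightarrow> 'a::euclidean_space set" where
  "shell s t = {x. exp (- t) < norm x \<and> norm x \<le> exp (- s)}"

lemma shell_borel [measurable]: "shell s t \<in> sets borel"
proof -
  have "shell s t = cball 0 (exp (- s)) - cball (0::'a) (exp (- t))" by (auto simp: shell_def)
  then show ?thesis by simp
qed

lemma scale_in_shell: "exp u *\<^sub>R x \<in> shell s t \<longleftrightarrow> x \<in> shell (s + u) (t + u)"
proof -
  have "exp (- t) < exp u * norm x \<longleftrightarrow> exp (-u) * exp (- t) < norm x"
    "exp u * norm x \<le> exp (- s) \<longleftrightarrow> norm x \<le> exp (-u) * exp (- s)"
    by (simp_all add: exp_minus field_simps)
  then show ?thesis by (simp add: shell_def add.commute flip: exp_add)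
qed

lemma dil_measure_shell_shift:
  "emeasure dil_measure (shell (s + u) (t + u) :: 'a::euclidean_space set) = emeasure dil_measure (shell s t :: 'a set)"
proof -
  have "emeasure dil_measure (shell (s + u) (t + u) :: 'a set)
      = (\<integral>\<^sup>+x. indicator (shell s t) (exp u *\<^sub>R x) \<partial>(dil_measure :: 'a measure))"
  proof -
    have "(\<lambda>x::'a. indicator (shell s t) (exp u *\<^sub>R x) :: ennreal) = indicator (shell (s + u) (t + u))"
      by (auto simp: indicator_def scale_in_shell)
    then show ?thesis by simp
  qed
  also have "\<dots> = (\<integral>\<^sup>+x. indicator (shell s t) x \<partial>(dil_measure :: 'a measure))"
    by (rule nn_integral_dil_measure_scale) auto
  finally show ?thesis by simp
qed

lemma dil_measure_shell_finite: "emeasure dil_measure (shell s t :: 'a::euclidean_space set) < \<infinity>"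
proof -
  have "emeasure dil_measure (shell s t :: 'a set) = (\<integral>\<^sup>+x. ennreal (1 / norm x ^ DIM('a)) * indicator (shell s t :: 'a set) x \<partial>lborel)"
    by (rule emeasure_dil_measure) simp
  also have "\<dots> \<le> (\<integral>\<^sup>+x. ennreal (1 / exp (- t) ^ DIM('a)) * indicator (cball (0::'a) (exp (- s))) x \<partial>lborel)"
    by (intro nn_integral_mono)
      (auto simp: indicator_def shell_def intro!: ennreal_leI divide_left_mono power_mono mult_pos_pos zero_less_power elim: less_trans[rotated])
  also have "\<dots> = ennreal (1 / exp (- t) ^ DIM('a)) * emeasure lborel (cball (0::'a) (exp (- s)))"
    by (subst nn_integral_cmult_indicator) auto
  also have "\<dots> < \<infinity>" using emeasure_lborel_cball_finite[of "0::'a" "exp (- s)"] by (simp add: ennreal_mult_less_top)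
  finally show ?thesis .
qed

lemma dil_measure_shell_pos:
  assumes "0 < t"
  shows "0 < emeasure dil_measure (shell 0 t :: 'a::euclidean_space set)"
proof -
  obtain b :: 'a where b: "b \<in> Basis" using nonempty_Basis by blast
  \<comment> \<open>Half the width of the shell: the ball of radius \<open>r\<close> about a point
    of norm \<open>1 - r\<close> lies between the spheres of radii
    \<open>1 - 2 * r = exp (- t)\<close> and 1. There the density is at least 1.\<close>
  define r where "r = (1 - exp (-t)) / 2"
  have r: "r > 0" using assms by (simp add: r_def)
  have sub: "ball ((1 - r) *\<^sub>R b) r \<subseteq> shell 0 t"
  proof
    fix x assume "x \<in> ball ((1 - r) *\<^sub>R b) r"
    then have d: "norm (x - (1 - r) *\<^sub>R b) < r" by (simp add: dist_norm norm_minus_commute)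
    have r1: "r < 1" by (simp add: r_def less_trans[of "-1" 0 "exp (- t)"])
    have n: "norm ((1 - r) *\<^sub>R b) = 1 - r" using b r1 by simp
    have "norm x \<le> 1" using norm_triangle_sub[of x "(1 - r) *\<^sub>R b"] d n by linarith
    moreover have "1 - 2 * r < norm x" using norm_triangle_sub[of "(1 - r) *\<^sub>R b" x] d n
      by (simp only: norm_minus_commute)
    moreover have "1 - 2 * r = exp (-t)" unfolding r_def by (simp add: field_simps)
    ultimately show "x \<in> shell 0 t" by (simp add: shell_def)
  qed
  have "0 < emeasure lborel (ball ((1 - r) *\<^sub>R b) r)"
    using content_ball_pos[OF r, of "(1 - r) *\<^sub>R b"] by (simp add: measure_def enn2real_positive_iff)
  also have "\<dots> \<le> emeasure lborel (shell 0 t :: 'a set)" by (rule emeasure_mono[OF sub]) simp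
  also have "\<dots> = (\<integral>\<^sup>+x. indicator (shell 0 t :: 'a set) x \<partial>lborel)"
    by (rule nn_integral_indicator[symmetric]) simp
  also have "\<dots> \<le> (\<integral>\<^sup>+x. ennreal (1 / norm x ^ DIM('a)) * indicator (shell 0 t :: 'a set) x \<partial>lborel)"
  proof (intro nn_integral_mono)
    fix x :: 'a
    have "ennreal (1 / norm x ^ DIM('a)) \<ge> 1" if "x \<in> shell 0 t"
    proof -
      have "0 < norm x" "norm x \<le> 1" using that less_trans[OF exp_gt_zero] by (auto simp: shell_def)
      then have "1 / norm x ^ DIM('a) \<ge> 1" by (simp add: power_le_one)
      then show ?thesis by (metis ennreal_1 ennreal_leI)
    qed
    then show "indicator (shell 0 t :: 'a set) x \<le> ennreal (1 / norm x ^ DIM('a)) * indicator (shell 0 t) x"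
      by (simp add: indicator_def)
  qed
  also have "\<dots> = emeasure dil_measure (shell 0 t :: 'a set)"
    by (rule emeasure_dil_measure[symmetric]) simp
  finally show ?thesis .
qed

text \<open>The shell is covered by \<open>l / t\<close>, rounded up, translates of the unit of
  length \<open>t\<close>. The rounding costs the summand 1, which amounts to only \<open>t\<close>
  once the bound is multiplied by \<open>t\<close>.\<close>

lemma dil_measure_shell_le:
  assumes t: "0 < t" and l: "0 \<le> l"
  shows "emeasure dil_measure (shell s (s + l) :: 'a::euclidean_space set)
    \<le> ennreal (l / t + 1) * emeasure dil_measure (shell 0 t :: 'a set)"
proof -
  let ?V = "emeasure dil_measure (shell 0 t :: 'a set)"
  have K: "emeasure dil_measure (shell s (s + of_nat k * t) :: 'a set) \<le> of_nat k * ?V" for k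
  proof (induction k)
    case 0
    have "shell s s = ({} :: 'a set)" by (auto simp: shell_def)
    then show ?case by simp
  next
    case (Suc k)
    have "shell s (s + of_nat (Suc k) * t) \<subseteq> shell s (s + of_nat k * t) \<union> shell (0 + (s + of_nat k * t)) (t + (s + of_nat k * t) )"
      by (auto simp: shell_def algebra_simps)
    then have "emeasure dil_measure (shell s (s + of_nat (Suc k) * t) :: 'a set)
        \<le> emeasure dil_measure (shell s (s + of_nat k * t) \<union> shell (0 + (s + of_nat k * t)) (t + (s + of_nat k * t)) :: 'a set)"
      by (rule emeasure_mono) simp
    also have "\<dots> \<le> emeasure dil_measure (shell s (s + of_nat k * t) :: 'a set)
        + emeasure dil_measure (shell (0 + (s + of_nat k * t)) (t + (s + of_nat k * t)) :: 'a set)"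
      by (rule emeasure_subadditive) simp_all
    also have "\<dots> \<le> of_nat k * ?V + ?V"
      unfolding dil_measure_shell_shift using Suc.IH by (rule add_right_mono)
    finally show ?case by (simp add: algebra_simps)
  qed
  define k where "k = nat \<lceil>l / t\<rceil>"
  have k: "l / t \<le> of_nat k" "real k \<le> l / t + 1" using t l by (simp_all add: k_def)
  have "s + l \<le> s + of_nat k * t" using k t by (simp add: field_simps)
  then have "shell s (s + l) \<subseteq> (shell s (s + of_nat k * t) :: 'a set)"
    unfolding shell_def by (auto intro: le_less_trans[rotated])
  then have "emeasure dil_measure (shell s (s + l) :: 'a set) \<le> emeasure dil_measure (shell s (s + of_nat k * t) :: 'a set)"
    by (rule emeasure_mono) simp
  also have "\<dots> \<le> of_nat k * ?V" by (rule K)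
  also have "\<dots> \<le> ennreal (l / t + 1) * ?V"
    using k(2) by (intro mult_right_mono) (simp_all add: ennreal_of_nat_eq_real_of_nat ennreal_leI)
  finally show ?thesis .
qed

section \<open>Energy of a conformal map and its average over rays\<close>

lemma abs_det_conformal:
  fixes f' :: "real^'n \<Rightarrow> real^'n"
  assumes lin: "linear f'" and n: "\<And>h. norm (f' h) = l * norm h" and l: "0 < l"
  shows "\<bar>det (matrix f')\<bar> = l ^ CARD('n)"
proof -
  define u where "u = (\<lambda>x. inverse l *\<^sub>R f' x)"
  have "orthogonal_transformation u"
    unfolding orthogonal_transformation u_def using lin l n
    by (auto simp: linear_compose_scale_right)
  then have 1: "\<bar>det (matrix u)\<bar> = 1" by simp
  have "matrix f' = (\<chi> i. l *s (matrix u) $ i)"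
    using l by (simp add: vec_eq_iff matrix_def u_def)
  then have "det (matrix f') = l ^ CARD('n) * det (matrix u)"
    by (simp add: det_rows_mul)
  then show ?thesis using 1 l by (simp add: abs_mult)
qed

text \<open>Substitute \<open>x = g y\<close>: the Jacobian of \<open>g\<close> is the
  \<open>n\<close>-th power of \<open>inverse (L (g y))\<close>, so the dilation cancels and
  \<open>1 / |y|^n\<close> remains. This is the conformal invariance of the \<open>n\<close>-energy
  of \<open>- ln |f|\<close>.\<close>

lemma conformal_volume_le:
  fixes f g :: "real^'n::{finite,wellorder} \<Rightarrow> real^'n::_"
  assumes c: "ball_conf f g L" and f0: "f 0 = 0" and A: "compact A" "A \<subseteq> ball 0 1 - {0}"
  shows "(\<integral>\<^sup>+x\<in>A. ennreal ((L x / norm (f x)) ^ CARD('n)) \<partial>lborel) \<le> emeasure dil_measure (f ` A)"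
proof -
  let ?n = "CARD('n)"
  let ?M = "\<lambda>y. inverse (L (g y))"
  let ?h = "\<lambda>x. (L x / norm (f x)) ^ ?n"
  have ci: "ball_conf g f ?M" by (rule ball_conf_inverse[OF c])
  have An: "norm x < 1" "x \<noteq> 0" if "x \<in> A" for x using A that by auto
  have fA: "norm y < 1" "y \<noteq> 0" if y: "y \<in> f ` A" for y
  proof -
    obtain x where x: "x \<in> A" "y = f x" using y by blast
    then show "norm y < 1" using ball_confD(1)[OF c] An by blast
    show "y \<noteq> 0" using ball_confD(3)[OF c An(1)[OF x(1)]] ball_confD(3)[OF c, of 0] An(2)[OF x(1)] f0 x by auto
  qed
  have cA: "compact (f ` A)"
    using A by (intro compact_continuous_image continuous_on_subset[OF ball_confD(8)[OF c]]) auto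
  have gfA: "g ` f ` A = A" using ball_confD(3)[OF c] An by (force simp: image_iff)
  obtain g' where g': "\<And>y. y \<in> f ` A \<Longrightarrow> (g has_derivative g' y) (at y)"
      "\<And>y h. y \<in> f ` A \<Longrightarrow> norm (g' y h) = ?M y * norm h"
  proof -
    have "\<forall>y\<in>f ` A. \<exists>D. (g has_derivative D) (at y) \<and> (\<forall>h. norm (D h) = ?M y * norm h)"
      using ball_conf_derivative[OF ci] fA by metis
    then show thesis using that by (metis (no_types, lifting) bchoice)
  qed
  have det: "\<bar>det (matrix (g' y))\<bar> * ?h (g y) = 1 / norm y ^ ?n" if y: "y \<in> f ` A" for y
  proof -
    have Mp: "?M y > 0" using ball_confD(5)[OF ci] fA[OF y] by blast
    have "\<bar>det (matrix (g' y))\<bar> = ?M y ^ ?n"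
      by (rule abs_det_conformal[OF has_derivative_linear[OF g'(1)[OF y]] g'(2)[OF y] Mp])
    then show ?thesis
      using Mp ball_confD(4)[OF c] fA[OF y] by (simp add: power_mult_distrib[symmetric] power_divide field_simps)
  qed
  have cont: "continuous_on (f ` A) (\<lambda>y. 1 / norm y ^ ?n)"
    using fA by (intro continuous_intros) auto
  have int1: "(\<lambda>y. 1 / norm y ^ ?n) integrable_on (f ` A)"
    using borel_integrable_compact[OF cA cont]
    by (intro set_borel_integral_eq_integral(1)) (simp add: set_integrable_def)
  then have int2: "(\<lambda>y. \<bar>det (matrix (g' y))\<bar> * ?h (g y)) integrable_on (f ` A)"
    using det by (auto cong: integrable_cong)
  have nonneg: "0 \<le> ?h x" if "x \<in> A" for x
    using ball_confD(5)[OF c] An[OF that] by (simp add: less_imp_le)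
  have le: "?h integrable_on g ` f ` A \<and> integral (g ` f ` A) ?h \<le> integral (f ` A) (\<lambda>y. \<bar>det (matrix (g' y))\<bar> * ?h (g y))"
  proof (rule integral_on_image_ubound_nonneg[where f="?h" and g=g and g'=g' and S="f ` A", OF _ _ int2])
    show "0 \<le> ?h (g y)" if "y \<in> f ` A" for y using nonneg gfA that by blast
    show "(g has_derivative g' y) (at y within f ` A)" if "y \<in> f ` A" for y
      using g'(1)[OF that] has_derivative_at_withinI by blast
  qed
  have "integral (f ` A) (\<lambda>y. \<bar>det (matrix (g' y))\<bar> * ?h (g y)) = integral (f ` A) (\<lambda>y. 1 / norm y ^ ?n)"
    using det by (intro integral_cong) auto
  with le gfA have le: "?h integrable_on A" "integral A ?h \<le> integral (f ` A) (\<lambda>y. 1 / norm y ^ ?n)" by auto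
  have "(\<integral>\<^sup>+x\<in>A. ennreal (?h x) \<partial>lborel) = ennreal (integral A ?h)"
    using nonneg le(1) by (intro nn_integral_has_integral_lebesgue') (auto simp: has_integral_integral)
  also have "\<dots> \<le> ennreal (integral (f ` A) (\<lambda>y. 1 / norm y ^ ?n))"
    using le(2) by (rule ennreal_leI)
  also have "\<dots> = (\<integral>\<^sup>+y\<in>f ` A. ennreal (1 / norm y ^ ?n) \<partial>lborel)"
    using int1 by (intro nn_integral_has_integral_lebesgue'[symmetric]) (auto simp: has_integral_integral)
  also have "\<dots> = emeasure dil_measure (f ` A)"
    using cA by (subst emeasure_dil_measure) (auto intro: compact_imp_closed borel_closed)
  finally show ?thesis .
qed

lemma sigma_finite_dil_measure: "sigma_finite_measure (dil_measure :: 'a::euclidean_space measure)"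
  unfolding dil_measure_def 
  by (subst sigma_finite_measure.sigma_finite_iff_density_finite'[OF lborel.sigma_finite_measure_axioms]) auto

text \<open>Exchange the integrals and undo the dilation by its invariance. A point \<open>y\<close>
  of the ring then counts for those \<open>u\<close> with \<open>exp u *\<^sub>R y\<close> in the
  initial shell, and they fill at most an interval of length \<open>t\<close>.\<close>

lemma dil_measure_orbit_le:
  fixes P :: "'a::euclidean_space \<Rightarrow> ennreal"
  assumes P [measurable]: "P \<in> borel_measurable borel" and t: "0 < t"
  shows "(\<integral>\<^sup>+x\<in>shell s (s + t). (\<integral>\<^sup>+u\<in>{0..M}. P (exp (- u) *\<^sub>R x) \<partial>lborel) \<partial>dil_measure)
    \<le> ennreal t * (\<integral>\<^sup>+y\<in>{y. exp (- (s + t + M)) \<le> norm y \<and> norm y \<le> exp (- s)}. P y \<partial>dil_measure)"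
proof -
  interpret pair_sigma_finite "dil_measure :: 'a measure" "lborel :: real measure"
    by (intro pair_sigma_finite.intro sigma_finite_dil_measure lborel.sigma_finite_measure_axioms)
  let ?D = "shell s (s + t) :: 'a set" and ?I = "{0..M}"
  let ?A = "{y::'a. exp (- (s + t + M)) \<le> norm y \<and> norm y \<le> exp (- s)}"
  have [measurable]: "(\<lambda>x. P (exp (- fst x) *\<^sub>R snd x)) \<in> borel_measurable (borel \<Otimes>\<^sub>M borel)"
    "(\<lambda>x. P (exp (- snd x) *\<^sub>R fst x)) \<in> borel_measurable (borel \<Otimes>\<^sub>M borel)"
    "(\<lambda>x::'a\<times>real. indicator ?D (exp (snd x) *\<^sub>R fst x) :: ennreal) \<in> borel_measurable (borel \<Otimes>\<^sub>M borel)"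
    by measurable
  have "(\<integral>\<^sup>+x\<in>?D. (\<integral>\<^sup>+u\<in>?I. P (exp (- u) *\<^sub>R x) \<partial>lborel) \<partial>dil_measure)
      = (\<integral>\<^sup>+x. (\<integral>\<^sup>+u. P (exp (- u) *\<^sub>R x) * indicator ?I u * indicator ?D x \<partial>lborel) \<partial>dil_measure)"
    by (intro nn_integral_cong nn_integral_multc[symmetric]) measurable
  also have "\<dots> = (\<integral>\<^sup>+u. (\<integral>\<^sup>+x. P (exp (- u) *\<^sub>R x) * indicator ?I u * indicator ?D x \<partial>dil_measure) \<partial>lborel)"
    by (rule Fubini'[symmetric]) (simp add: case_prod_beta', measurable)
  also have "\<dots> = (\<integral>\<^sup>+u. (\<integral>\<^sup>+x. P x * indicator ?I u * indicator ?D (exp u *\<^sub>R x) \<partial>dil_measure) \<partial>lborel)"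
  proof (rule nn_integral_cong)
    fix u :: real
    have "(\<integral>\<^sup>+x. P (exp (- u) *\<^sub>R x) * indicator ?I u * indicator ?D (exp u *\<^sub>R exp (- u) *\<^sub>R x) \<partial>dil_measure)
        = (\<integral>\<^sup>+x. P x * indicator ?I u * indicator ?D (exp u *\<^sub>R x) \<partial>dil_measure)"
      by (rule nn_integral_dil_measure_scale[where h="\<lambda>x. P x * indicator ?I u * indicator ?D (exp u *\<^sub>R x)"]) auto
    then show "(\<integral>\<^sup>+x. P (exp (- u) *\<^sub>R x) * indicator ?I u * indicator ?D x \<partial>dil_measure)
        = (\<integral>\<^sup>+x. P x * indicator ?I u * indicator ?D (exp u *\<^sub>R x) \<partial>dil_measure)"
      by (simp flip: exp_add)
  qed
  also have "\<dots> = (\<integral>\<^sup>+x. (\<integral>\<^sup>+u. P x * indicator ?I u * indicator ?D (exp u *\<^sub>R x) \<partial>lborel) \<partial>dil_measure)"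
    by (rule Fubini') (simp add: case_prod_beta', measurable)
  also have "\<dots> \<le> (\<integral>\<^sup>+x. ennreal t * (P x * indicator ?A x) \<partial>dil_measure)"
  proof (rule nn_integral_mono)
    fix x :: 'a
    have *: "(\<integral>\<^sup>+u. P x * indicator ?I u * indicator ?D (exp u *\<^sub>R x) \<partial>lborel)
        = P x * (\<integral>\<^sup>+u. indicator ?I u * indicator ?D (exp u *\<^sub>R x) \<partial>lborel)"
      by (simp add: mult.assoc) (rule nn_integral_cmult, measurable)
    \<comment> \<open>Membership in the dilated shell means
      \<open>s + u \<le> - ln |x| < s + t + u\<close>, which confines \<open>u\<close> to the
      displayed interval; \<open>0 \<le> u \<le> M\<close> then puts \<open>x\<close> into
      \<open>?A\<close>.\<close>
    have "(\<integral>\<^sup>+u. indicator ?I u * indicator ?D (exp u *\<^sub>R x) \<partial>lborel)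
        \<le> (\<integral>\<^sup>+u. indicator ?A x * indicator {- ln (norm x) - s - t .. - ln (norm x) - s} u \<partial>lborel)"
    proof (rule nn_integral_mono)
      fix u :: real
      show "indicator ?I u * indicator ?D (exp u *\<^sub>R x)
        \<le> (indicator ?A x * indicator {- ln (norm x) - s - t .. - ln (norm x) - s} u :: ennreal)"
      proof (cases "u \<in> ?I \<and> exp u *\<^sub>R x \<in> ?D")
        case True
        then have u: "0 \<le> u" "u \<le> M" and x: "exp (- (s + t + u)) < norm x" "norm x \<le> exp (- (s + u))"
          unfolding scale_in_shell by (auto simp: shell_def)
        have xp: "0 < norm x" using x(1) less_trans[OF exp_gt_zero] by blast
        have "exp (- (s + t + M)) \<le> exp (- (s + t + u))" "exp (- (s + u)) \<le> exp (- s)" using u by auto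
        then have "exp (- (s + t + M)) \<le> norm x" "norm x \<le> exp (- s)" using x by linarith+
        then have "x \<in> ?A" by blast
        moreover have "- (s + t + u) < ln (norm x)" "ln (norm x) \<le> - (s + u)"
          using x xp by (metis exp_less_cancel_iff exp_ln, metis exp_le_cancel_iff exp_ln)
        ultimately show ?thesis by (auto simp: indicator_def)
      qed (auto simp: indicator_def)
    qed
    also have "\<dots> = indicator ?A x * ennreal t"
      using t by (simp add: nn_integral_cmult)
    finally have "(\<integral>\<^sup>+u. indicator ?I u * indicator ?D (exp u *\<^sub>R x) \<partial>lborel) \<le> indicator ?A x * ennreal t" .
    then show "(\<integral>\<^sup>+u. P x * indicator ?I u * indicator ?D (exp u *\<^sub>R x) \<partial>lborel) \<le> ennreal t * (P x * indicator ?A x)"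
      unfolding * by (subst mult.left_commute, subst (2) mult.commute) (rule mult_left_mono, simp_all)
  qed
  also have "\<dots> = ennreal t * (\<integral>\<^sup>+y\<in>?A. P y \<partial>dil_measure)"
  proof (rule nn_integral_cmult)
    have "?A = cball 0 (exp (- s)) - ball 0 (exp (- (s + t + M)))" by auto
    then have "?A \<in> sets borel" by simp
    then show "(\<lambda>x. P x * indicator ?A x) \<in> borel_measurable dil_measure" by simp
  qed
  finally show ?thesis .
qed

section \<open>Growth of \<open>|f|\<close> along rays\<close>

lemma ball_conf_eq_0_iff:
  assumes "ball_conf f g L" "f 0 = 0" "norm x < 1"
  shows "f x = 0 \<longleftrightarrow> x = 0"
proof
  have "g 0 = 0" using ball_confD(3)[OF assms(1), of 0] assms(2) by simp
  then show "f x = 0 \<Longrightarrow> x = 0" using ball_confD(3)[OF assms(1,3)] by simp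
qed (simp add: assms(2))

text \<open>The chain rule for the norm, which is differentiable away from 0, and Cauchy-Schwarz. It
  is applied to two parametrizations of a radius: an exponential one for the energy and a linear one
  for hyperbolic length.\<close>

lemma ball_conf_has_derivative_norm_path:
  assumes c: "ball_conf f g L" and f0: "f 0 = 0"
    and v: "(v has_vector_derivative v') (at s)" "norm (v s) < 1" "v s \<noteq> 0"
  obtains d where "((\<lambda>s. norm (f (v s))) has_real_derivative d) (at s)" "\<bar>d\<bar> \<le> L (v s) * norm v'"
proof -
  obtain f' where f': "(f has_derivative f') (at (v s))" and n: "\<And>h. norm (f' h) = L (v s) * norm h"
    using ball_conf_derivative[OF c v(2)] by blast
  have nz: "f (v s) \<noteq> 0" using ball_conf_eq_0_iff[OF c f0 v(2)] v(3) by simp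
  have "((\<lambda>s. f (v s)) has_derivative (\<lambda>t. f' (t *\<^sub>R v'))) (at s)"
    using v(1) f' unfolding has_vector_derivative_def by (rule has_derivative_compose)
  moreover have "f' (t *\<^sub>R v') = t *\<^sub>R f' v'" for t
    using f' has_derivative_linear linear_cmul by blast
  ultimately have 1: "((\<lambda>s. f (v s)) has_derivative (\<lambda>t. t *\<^sub>R f' v')) (at s)" by simp
  have "((\<lambda>s. norm (f (v s))) has_derivative (\<lambda>t. (t *\<^sub>R f' v') \<bullet> sgn (f (v s)))) (at s)"
    using has_derivative_compose[OF 1 has_derivative_norm[OF nz]] .
  then have "((\<lambda>s. norm (f (v s))) has_real_derivative (f' v' \<bullet> sgn (f (v s)))) (at s)"
    by (simp add: has_field_derivative_def mult_commute_abs)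
  moreover have "\<bar>f' v' \<bullet> sgn (f (v s))\<bar> \<le> L (v s) * norm v'"
    using Cauchy_Schwarz_ineq2[of "f' v'" "sgn (f (v s))"] nz by (simp add: n norm_sgn)
  ultimately show thesis using that by blast
qed

lemma exp_path_derivative:
  "((\<lambda>s. exp (- s) *\<^sub>R x) has_vector_derivative (- exp (- s)) *\<^sub>R x) (at s within S)"
  by (auto intro!: derivative_eq_intros simp: has_vector_derivative_def)

text \<open>Young's inequality in the form \<open>n t \<le> t\<^sup>n + (n - 1)\<close>, integrated along the ray through \<open>x\<close>.\<close>
lemma ball_conf_ray_estimate:
  fixes f :: "'a::euclidean_space \<Rightarrow> 'a"
  assumes c: "ball_conf f g L" and f0: "f 0 = 0" and x: "x \<noteq> 0" "norm x < 1" and M: "0 \<le> M" and n: "1 \<le> n"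
  shows "ennreal (real n * (ln (norm (f x)) - ln (norm (f (exp (- M) *\<^sub>R x)))))
    \<le> (\<integral>\<^sup>+u\<in>{0..M}. ennreal ((L (exp (- u) *\<^sub>R x) * norm (exp (- u) *\<^sub>R x) / norm (f (exp (- u) *\<^sub>R x))) ^ n) \<partial>lborel)
      + ennreal ((real n - 1) * M)"
proof -
  define p where "p u = exp (- u) *\<^sub>R x" for u
  define q where "q u = L (p u) * norm (p u) / norm (f (p u))" for u
  have p1: "norm (p u) < 1" if "0 \<le> u" for u
  proof -
    have "exp (- u) * norm x \<le> 1 * norm x" using that by (intro mult_right_mono) auto
    also have "\<dots> < 1" using x by simp
    finally show ?thesis by (simp add: p_def)
  qed
  have p0: "p u \<noteq> 0" for u using x by (simp add: p_def)
  have fp: "f (p u) \<noteq> 0" if "0 \<le> u" for u using ball_conf_eq_0_iff[OF c f0 p1[OF that]] p0 by simp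
  have cp: "continuous_on S p" for S unfolding p_def by (intro continuous_intros)
  have cfp: "continuous_on {0..M} (\<lambda>u. f (p u))"
    by (rule continuous_on_compose2[OF ball_confD(8)[OF c] cp]) (use p1 in auto)
  have cLp: "continuous_on {0..M} (\<lambda>u. L (p u))"
    by (rule continuous_on_compose2[OF ball_confD(10)[OF c] cp]) (use p1 in auto)
  have cq: "continuous_on {0..M} (\<lambda>u. q u ^ n)"
    unfolding q_def using fp by (intro continuous_intros cLp cfp cp) auto
  have q0: "0 \<le> q u" if "0 \<le> u" for u
    unfolding q_def using ball_confD(5)[OF c p1[OF that]] by (simp add: less_imp_le)
  \<comment> \<open>The claim is \<open>F M \<le> F 0\<close>. In the derivative of \<open>F\<close>
    the first term is \<open>n\<close> times the rate of \<open>- ln |f|\<close>, which is at most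
    \<open>q u\<close>.\<close>
  define F where "F u = - real n * ln (norm (f (p u))) - (real n - 1) * u - integral {0..u} (\<lambda>u. q u ^ n)" for u
  have cint: "continuous_on {0..M} (\<lambda>u. integral {0..u} (\<lambda>u. q u ^ n))"
    by (rule indefinite_integral_continuous_1) (rule integrable_continuous_interval[OF cq])
  have cF: "continuous_on {0..M} F"
    unfolding F_def using fp by (intro continuous_intros cint cfp) auto
  have "F M \<le> F 0"
  proof (rule DERIV_nonpos_imp_decreasing_open[OF M _ cF])
    fix u assume u: "0 < u" "u < M"
    have u': "0 \<le> u" "norm (p u) < 1" using u p1 by auto
    obtain d where d: "((\<lambda>u. norm (f (p u))) has_real_derivative d) (at u)" "\<bar>d\<bar> \<le> L (p u) * norm (- exp (- u) *\<^sub>R x)"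
      using ball_conf_has_derivative_norm_path[OF c f0, of p "- exp (- u) *\<^sub>R x" u] exp_path_derivative[of x u UNIV] u' p0
      unfolding p_def[abs_def] by metis
    have pd: "norm (- exp (- u) *\<^sub>R x) = norm (p u)" by (simp add: p_def)
    have fpp: "norm (f (p u)) > 0" using fp u' by simp
    have I: "((\<lambda>u. integral {0..u} (\<lambda>u. q u ^ n)) has_real_derivative q u ^ n) (at u)"
      using integral_has_real_derivative[OF cq, of u] u at_within_Icc_at[of 0 u M] by simp
    have "(F has_real_derivative (- real n * (inverse (norm (f (p u))) * d) - (real n - 1) - q u ^ n)) (at u)"
      unfolding F_def using fpp by (auto intro!: derivative_eq_intros d(1) I simp: divide_inverse mult_ac)
    moreover have "- real n * (inverse (norm (f (p u))) * d) - (real n - 1) - q u ^ n \<le> 0"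
    proof -
      have "- (inverse (norm (f (p u))) * d) \<le> q u"
      proof -
        have "- d \<le> L (p u) * norm (p u)" using d(2) unfolding pd by linarith
        then have "- d / norm (f (p u)) \<le> q u" unfolding q_def using fpp by (intro divide_right_mono) auto
        then show ?thesis by (simp add: divide_inverse mult.commute)
      qed
      then have "real n * (- (inverse (norm (f (p u))) * d)) \<le> real n * q u" by (rule mult_left_mono) simp
      \<comment> \<open>This is the announced inequality \<open>n q \<le> q ^ n + (n - 1)\<close>,
        obtained from Bernoulli for \<open>q - 1 \<ge> -1\<close>.\<close>
      moreover have "1 + real n * (q u - 1) \<le> (1 + (q u - 1)) ^ n"
        using q0[OF u'(1)] by (intro Bernoulli_inequality) auto
      ultimately show ?thesis by (simp add: algebra_simps)
    qed
    ultimately show "\<exists>y. (F has_real_derivative y) (at u) \<and> y \<le> 0" by blast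
  qed
  then have *: "real n * (ln (norm (f x)) - ln (norm (f (p M)))) \<le> integral {0..M} (\<lambda>u. q u ^ n) + (real n - 1) * M"
    by (simp add: F_def p_def algebra_simps)
  have "(\<integral>\<^sup>+u\<in>{0..M}. ennreal (q u ^ n) \<partial>lborel) = ennreal (integral {0..M} (\<lambda>u. q u ^ n))"
    using q0 by (intro nn_integral_has_integral_lebesgue' integrable_integral integrable_continuous_interval[OF cq]) auto
  moreover have "0 \<le> integral {0..M} (\<lambda>u. q u ^ n)"
    using q0 by (intro integral_nonneg integrable_continuous_interval[OF cq]) auto
  ultimately have "(\<integral>\<^sup>+u\<in>{0..M}. ennreal (q u ^ n) \<partial>lborel) + ennreal ((real n - 1) * M)
      = ennreal (integral {0..M} (\<lambda>u. q u ^ n) + (real n - 1) * M)"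
    using M n by (subst ennreal_plus) auto
  then show ?thesis using ennreal_leI[OF *] by (simp add: q_def p_def)
qed

section \<open>The Schwarz lemma\<close>

lemma ball_conf_near_0:
  assumes c: "ball_conf f g L" and f0: "f 0 = 0" and K: "L 0 < K"
  obtains \<delta> where "0 < \<delta>" "\<delta> < 1" "\<And>x. norm x < \<delta> \<Longrightarrow> norm (f x) \<le> K * norm x"
proof -
  obtain f' where f': "(f has_derivative f') (at 0)" and n: "\<And>h. norm (f' h) = L 0 * norm h"
    using ball_conf_derivative[OF c, of 0] by auto
  then obtain d where d: "0 < d" "\<And>y. norm (y - 0) < d \<Longrightarrow> norm (f y - f 0 - f' (y - 0)) \<le> (K - L 0) * norm (y - 0)"
    using K unfolding has_derivative_at_alt by (metis diff_gt_0_iff_gt)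
  have "norm (f x) \<le> K * norm x" if "norm x < min d (1/2)" for x
  proof -
    have "norm (f x) \<le> norm (f x - f' x) + norm (f' x)" by (metis norm_triangle_sub add.commute)
    also have "\<dots> \<le> (K - L 0) * norm x + L 0 * norm x"
      using d(2)[of x] that f0 n by simp
    finally show ?thesis by (simp add: algebra_simps)
  qed
  then show thesis using d(1) by (intro that[of "min d (1/2)"]) auto
qed

text \<open>The points with \<open>|f x| \<le> r\<close> form the compact image of
  \<open>cball 0 r\<close> under \<open>g\<close>, which keeps a distance from the unit sphere.
  Hence \<open>|f x|\<close> tends to 1 as \<open>|x|\<close> does.\<close>

lemma ball_conf_proper:
  assumes c: "ball_conf f g L" and r: "r < 1"
  obtains R where "0 < R" "R < 1" "\<And>x. R < norm x \<Longrightarrow> norm x < 1 \<Longrightarrow> r < norm (f x)"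
proof -
  have "compact (g ` cball 0 r)"
    using r by (intro compact_continuous_image continuous_on_subset[OF ball_confD(9)[OF c]]) auto
  moreover have "g ` cball 0 r \<subseteq> ball 0 1" using ball_confD(2)[OF c] r by force
  ultimately obtain R where R: "R < 1" "g ` cball 0 r \<subseteq> cball 0 R"
  proof (cases "g ` cball 0 r = {}")
    case False
    have "continuous_on (g ` cball 0 r) norm" by (intro continuous_intros)
    from continuous_attains_sup[OF \<open>compact _\<close> False this]
    obtain z where z: "z \<in> g ` cball 0 r" "\<forall>y\<in>g ` cball 0 r. norm y \<le> norm z"
      by (elim bexE)
    have "norm z < 1" using z(1) \<open>g ` cball 0 r \<subseteq> ball 0 1\<close> by (meson mem_ball_0 subsetD)
    moreover have "g ` cball 0 r \<subseteq> cball 0 (norm z)" using z(2) by auto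
    ultimately show thesis by (rule that)
  qed (use that[of 0] in auto)
  have "r < norm (f x)" if x: "max R (1/2) < norm x" "norm x < 1" for x
  proof (rule ccontr)
    assume "\<not> r < norm (f x)"
    then have "g (f x) \<in> g ` cball 0 r" by auto
    then have "norm x \<le> R" using R(2) ball_confD(3)[OF c x(2)] by auto
    then show False using x by simp
  qed
  then show thesis using R(1) by (intro that[of "max R (1/2)"]) auto
qed

text \<open>If \<open>L 0 = exp (- l)\<close> with \<open>l > 0\<close>, the length-area inequality fails by \<open>(n - 1) l\<close>,
  up to error terms of size \<open>\<sigma>\<close>.\<close>
lemma schwarz_derivative_ge_1_wellorder:
  fixes f g :: "real^'n::{finite,wellorder} \<Rightarrow> real^'n::_"
  assumes c: "ball_conf f g L" and f0: "f 0 = 0" and n2: "CARD('n) \<ge> 2"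
  shows "1 \<le> L 0"
proof (rule ccontr)
  assume "\<not> 1 \<le> L 0"
  define n where "n = CARD('n)"
  define l where "l = - ln (L 0)"
  have Lp: "0 < L 0" using ball_confD(5)[OF c, of 0] by simp
  have l: "0 < l" "L 0 = exp (- l)" using \<open>\<not> 1 \<le> L 0\<close> Lp by (simp_all add: l_def)
  \<comment> \<open>The errors will add up to \<open>(2 * n + 2) * \<sigma> + 3 * t\<close> with
    \<open>t \<le> \<sigma>\<close>. This choice makes them at most \<open>l / 2\<close>, while the
    gain \<open>(n - 1) * l\<close> is at least \<open>l\<close>.\<close>
  define \<sigma> where "\<sigma> = l / (2 * (2 * real n + 5))"
  have s: "0 < \<sigma>" "(2 * real n + 5) * \<sigma> = l / 2" using l by (simp_all add: \<sigma>_def field_simps)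
  obtain R where R: "0 < R" "R < 1" "\<And>x. R < norm x \<Longrightarrow> norm x < 1 \<Longrightarrow> exp (- \<sigma>) < norm (f x)"
    using ball_conf_proper[OF c, of "exp (- \<sigma>)"] s by auto
  \<comment> \<open>The rays start in the shell \<open>exp (- 2 * t) < |x| \<le> exp (- t)\<close>:
    far enough out that \<open>|f x| > exp (- \<sigma>)\<close>, yet inside a compact part of the
    open ball.\<close>
  define t where "t = min \<sigma> (- ln R / 2)"
  have t: "0 < t" "t \<le> \<sigma>" using R s by (auto simp: t_def)
  have "2 * t \<le> - ln R" by (simp add: t_def)
  then have "exp (ln R) \<le> exp (- 2 * t)" by simp
  then have tR: "R \<le> exp (- 2 * t)" using R(1) by simp
  have ci: "ball_conf g f (\<lambda>y. inverse (L (g y)))" by (rule ball_conf_inverse[OF c])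
  have g0: "g 0 = 0" using ball_confD(3)[OF c, of 0] f0 by simp
  obtain d1 where d1: "0 < d1" "d1 < 1" "\<And>x. norm x < d1 \<Longrightarrow> norm (f x) \<le> exp (\<sigma> - l) * norm x"
    using ball_conf_near_0[OF c f0, of "exp (\<sigma> - l)"] l s by auto
  obtain d2 where d2: "0 < d2" "d2 < 1" "\<And>x. norm x < d2 \<Longrightarrow> norm (g x) \<le> exp (\<sigma> + l) * norm x"
    using ball_conf_near_0[OF ci g0, of "exp (\<sigma> + l)"] l s g0 by (auto simp flip: exp_minus)
  define d where "d = min d1 d2"
  have d: "0 < d" "d < 1" using d1 d2 by (auto simp: d_def)
  \<comment> \<open>Thus \<open>exp (- M) = d / exp 1\<close>. The inner ends of the rays lie in the
    region where the linear bound for \<open>f\<close> holds, and points of norm at most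
    \<open>exp (- M)\<close> in the region where that for \<open>g\<close> holds.\<close>
  define M where "M = 1 - ln d"
  have M: "0 \<le> M" "exp (- M) < d"
  proof -
    show "0 \<le> M" using ln_less_zero[OF d] unfolding M_def by linarith
    have "exp (- M) < exp (ln d)" by (simp add: M_def)
    then show "exp (- M) < d" using d by simp
  qed
  let ?D = "shell (0 + t) (t + t) :: (real^'n::_) set"
  let ?V = "emeasure dil_measure (shell 0 t :: (real^'n::_) set)"
  let ?A = "{y. exp (- (t + t + M)) \<le> norm (y :: real^'n::_) \<and> norm y \<le> exp (- t)}"
  let ?q = "\<lambda>y. L y * norm y / norm (f y)"
  \<comment> \<open>The cutoff makes the integrand Borel on the whole space; all the points at which
    it is evaluated below lie in the punctured ball.\<close>
  define P where "P y = ennreal (indicator (ball 0 1 - {0}) y * ?q y ^ n)" for y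
  have P: "P \<in> borel_measurable borel"
  proof -
    have "continuous_on (ball 0 1 - {0}) (\<lambda>y. ?q y ^ n)"
      using ball_conf_eq_0_iff[OF c f0]
      by (intro continuous_intros continuous_on_subset[OF ball_confD(8)[OF c]] continuous_on_subset[OF ball_confD(10)[OF c]]) auto
    then have "(\<lambda>y. indicator (ball 0 1 - {0}) y *\<^sub>R ?q y ^ n) \<in> borel_measurable borel"
      by (intro borel_measurable_continuous_on_indicator) auto
    then show ?thesis unfolding P_def by simp
  qed
  have V: "0 < ?V" "?V < \<infinity>" using dil_measure_shell_pos[OF t(1)] dil_measure_shell_finite by auto
  have VD: "emeasure dil_measure ?D = ?V" by (rule dil_measure_shell_shift)
  have n1: "1 \<le> n" using n2 by (simp add: n_def)
  \<comment> \<open>At the outer end \<open>- ln |f|\<close> is at most \<open>\<sigma>\<close>, at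
    the inner end at least \<open>M + l - \<sigma>\<close>; the difference enters the ray
    estimate.\<close>
  have ray: "ennreal (real n * (M + l - 2 * \<sigma>))
      \<le> (\<integral>\<^sup>+u\<in>{0..M}. P (exp (- u) *\<^sub>R x) \<partial>lborel) + ennreal ((real n - 1) * M)" if x: "x \<in> ?D" for x
  proof -
    have nx: "exp (- 2 * t) < norm x" "norm x \<le> exp (- t)" using x by (auto simp: shell_def)
    have "exp (- t) < 1" using t by simp
    with nx have x1: "norm x < 1" by linarith
    have x0: "x \<noteq> 0" using nx(1) less_trans[OF exp_gt_zero nx(1)] by auto
    have "exp (- \<sigma>) < norm (f x)" using R(3)[of x] nx x1 tR by linarith
    then have a: "- \<sigma> \<le> ln (norm (f x))" by (metis exp_gt_zero less_imp_le ln_exp ln_le_cancel_iff less_trans)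
    have *: "norm (exp (- M) *\<^sub>R x) \<le> exp (- M)" using x1 by simp
    then have nM: "norm (exp (- M) *\<^sub>R x) < 1" using M d by linarith
    have "norm (f (exp (- M) *\<^sub>R x)) \<le> exp (\<sigma> - l) * norm (exp (- M) *\<^sub>R x)"
      using le_less_trans[OF * M(2)] by (intro d1(3)) (simp add: d_def)
    also have "\<dots> \<le> exp (\<sigma> - l) * exp (- M)" using * by (intro mult_left_mono) auto
    also have "\<dots> = exp (\<sigma> - l - M)" by (simp flip: exp_add)
    finally have "norm (f (exp (- M) *\<^sub>R x)) \<le> exp (\<sigma> - l - M)" .
    moreover have "0 < norm (f (exp (- M) *\<^sub>R x))" using ball_conf_eq_0_iff[OF c f0 nM] x0 by simp
    ultimately have b: "ln (norm (f (exp (- M) *\<^sub>R x))) \<le> \<sigma> - l - M" by (metis exp_gt_zero ln_exp ln_le_cancel_iff)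
    have "real n * (M + l - 2 * \<sigma>) \<le> real n * (ln (norm (f x)) - ln (norm (f (exp (- M) *\<^sub>R x))))"
      using a b by (intro mult_left_mono) auto
    then have "ennreal (real n * (M + l - 2 * \<sigma>)) \<le> ennreal (real n * (ln (norm (f x)) - ln (norm (f (exp (- M) *\<^sub>R x)))))"
      by (rule ennreal_leI)
    also have "\<dots> \<le> (\<integral>\<^sup>+u\<in>{0..M}. ennreal (?q (exp (- u) *\<^sub>R x) ^ n) \<partial>lborel) + ennreal ((real n - 1) * M)"
      by (rule ball_conf_ray_estimate[OF c f0 x0 x1 M(1) n1])
    also have "(\<integral>\<^sup>+u\<in>{0..M}. ennreal (?q (exp (- u) *\<^sub>R x) ^ n) \<partial>lborel) = (\<integral>\<^sup>+u\<in>{0..M}. P (exp (- u) *\<^sub>R x) \<partial>lborel)"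
    proof (intro nn_integral_cong)
      fix u
      have "exp (- u) *\<^sub>R x \<in> ball 0 1 - {0}" if "0 \<le> u"
      proof -
        have "exp (- u) * norm x \<le> 1 * norm x" using that by (intro mult_right_mono) auto
        also have "\<dots> < 1" using x1 by simp
        finally show ?thesis using x0 by simp
      qed
      then show "ennreal (?q (exp (- u) *\<^sub>R x) ^ n) * indicator {0..M} u = P (exp (- u) *\<^sub>R x) * indicator {0..M} u"
        by (auto simp: P_def indicator_def)
    qed
    finally show ?thesis .
  qed
  \<comment> \<open>The linear bound for \<open>g\<close> keeps images away from 0. Of the
    \<open>2 * \<sigma>\<close> in the width, one \<open>\<sigma>\<close> pays for that bound and
    the other yields the strict inequality that gives the contradiction.\<close>
  have fA: "f ` ?A \<subseteq> shell 0 (0 + (M + 2 * t + l + 2 * \<sigma>))"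
  proof
    fix z assume "z \<in> f ` ?A"
    then obtain y where y: "exp (- (t + t + M)) \<le> norm y" "norm y \<le> exp (- t)" "z = f y" by blast
    have "exp (- t) < 1" using t by simp
    with y have y1: "norm y < 1" by linarith
    have z1: "norm z < 1" using ball_confD(1)[OF c y1] y by simp
    have "exp (- (M + 2 * t + l + 2 * \<sigma>)) < norm z"
    proof (rule ccontr)
      assume "\<not> ?thesis"
      then have z: "norm z \<le> exp (- (M + 2 * t + l + 2 * \<sigma>))" by simp
      also have "\<dots> \<le> exp (- M)" using t l s by simp
      finally have "norm z < d2" using M by (simp add: d_def)
      then have "norm y \<le> exp (\<sigma> + l) * norm z" using d2(3)[of z] y(3) ball_confD(3)[OF c y1] by simp
      also have "\<dots> \<le> exp (\<sigma> + l) * exp (- (M + 2 * t + l + 2 * \<sigma>))" using z by (intro mult_left_mono) auto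
      also have "\<dots> = exp (- (M + 2 * t + \<sigma>))" by (simp flip: exp_add)
      also have "\<dots> < exp (- (t + t + M))" using s by simp
      finally show False using y by simp
    qed
    then show "z \<in> shell 0 (0 + (M + 2 * t + l + 2 * \<sigma>))" using z1 by (simp add: shell_def)
  qed
  have cA: "compact ?A"
  proof -
    have "?A = cball 0 (exp (- t)) - ball 0 (exp (- (t + t + M)))" by auto
    then show ?thesis by (simp add: compact_diff)
  qed
  have Asub: "?A \<subseteq> ball 0 1 - {0}"
  proof
    fix y assume "y \<in> ?A"
    then have "exp (- (t + t + M)) \<le> norm y" "norm y \<le> exp (- t)" by auto
    moreover have "exp (- t) < 1" using t by simp
    ultimately have "norm y < 1" "0 < norm y" using exp_gt_zero[of "- (t + t + M)"] by linarith+
    then show "y \<in> ball 0 1 - {0}" by simp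
  qed
  define T where "T = M + 2 * t + l + 2 * \<sigma>"
  have T: "0 \<le> T" using M t l s by (simp add: T_def)
  have "(\<integral>\<^sup>+y\<in>?A. P y \<partial>dil_measure) = (\<integral>\<^sup>+y\<in>?A. ennreal ((L y / norm (f y)) ^ CARD('n)) \<partial>lborel)"
  proof -
    have mA: "?A \<in> sets borel" using cA by (intro borel_closed compact_imp_closed)
    have "(\<integral>\<^sup>+y\<in>?A. P y \<partial>dil_measure) = (\<integral>\<^sup>+y. ennreal (1 / norm y ^ DIM(real^'n::_)) * (P y * indicator ?A y) \<partial>lborel)"
      using P mA by (intro nn_integral_dil_measure) simp
    also have "\<dots> = (\<integral>\<^sup>+y\<in>?A. ennreal ((L y / norm (f y)) ^ CARD('n)) \<partial>lborel)"
    proof (rule nn_integral_cong)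
      fix y
      show "ennreal (1 / norm y ^ DIM(real^'n::_)) * (P y * indicator ?A y) = ennreal ((L y / norm (f y)) ^ CARD('n)) * indicator ?A y"
      proof (cases "y \<in> ?A")
        case True
        then have y: "norm y < 1" "y \<noteq> 0" using Asub by auto
        have "1 / norm y ^ n * ?q y ^ n = (L y / norm (f y)) ^ n"
          using y by (simp add: power_mult_distrib power_divide)
        moreover have "0 \<le> ?q y ^ n" using ball_confD(5)[OF c y(1)] by simp
        ultimately show ?thesis using True y by (simp add: P_def n_def flip: ennreal_mult')
      qed simp
    qed
    finally show ?thesis .
  qed
  also have "\<dots> \<le> emeasure dil_measure (f ` ?A)" by (rule conformal_volume_le[OF c f0 cA Asub])
  also have "\<dots> \<le> emeasure dil_measure (shell 0 (0 + T) :: (real^'n::_) set)"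
    using fA unfolding T_def by (rule emeasure_mono) simp
  also have "\<dots> \<le> ennreal (T / t + 1) * ?V" by (rule dil_measure_shell_le[OF t(1) T])
  finally have energy: "(\<integral>\<^sup>+y\<in>?A. P y \<partial>dil_measure) \<le> ennreal (T / t + 1) * ?V" .
  have "(\<integral>\<^sup>+x\<in>?D. (\<integral>\<^sup>+u\<in>{0..M}. P (exp (- u) *\<^sub>R x) \<partial>lborel) \<partial>dil_measure) \<le> ennreal t * (\<integral>\<^sup>+y\<in>?A. P y \<partial>dil_measure)"
    using dil_measure_orbit_le[OF P t(1), where s=t and M=M] by simp
  also have "\<dots> \<le> ennreal t * (ennreal (T / t + 1) * ?V)" using energy by (rule mult_left_mono) simp
  finally have orbits: "(\<integral>\<^sup>+x\<in>?D. (\<integral>\<^sup>+u\<in>{0..M}. P (exp (- u) *\<^sub>R x) \<partial>lborel) \<partial>dil_measure) \<le> ennreal t * (ennreal (T / t + 1) * ?V)" .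
  \<comment> \<open>Integrate the ray estimate over the initial shell. All terms are multiples of
    its measure \<open>?V\<close>, which is positive and finite and can be cancelled.\<close>
  have "ennreal (real n * (M + l - 2 * \<sigma>)) * ?V = (\<integral>\<^sup>+x. ennreal (real n * (M + l - 2 * \<sigma>)) * indicator ?D x \<partial>dil_measure)"
    by (simp add: nn_integral_cmult_indicator VD[symmetric])
  also have "\<dots> \<le> (\<integral>\<^sup>+x. (\<integral>\<^sup>+u\<in>{0..M}. P (exp (- u) *\<^sub>R x) \<partial>lborel) * indicator ?D x + ennreal ((real n - 1) * M) * indicator ?D x \<partial>dil_measure)"
    using ray by (intro nn_integral_mono) (auto simp: indicator_def)
  also have "\<dots> = (\<integral>\<^sup>+x\<in>?D. (\<integral>\<^sup>+u\<in>{0..M}. P (exp (- u) *\<^sub>R x) \<partial>lborel) \<partial>dil_measure) + ennreal ((real n - 1) * M) * ?V"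
  proof -
    have [measurable]: "(\<lambda>x. P (exp (- snd x) *\<^sub>R fst x)) \<in> borel_measurable (borel \<Otimes>\<^sub>M borel)"
      using P by measurable
    have "(\<lambda>x. (\<integral>\<^sup>+u\<in>{0..M}. P (exp (- u) *\<^sub>R x) \<partial>lborel)) \<in> borel_measurable borel"
      by (rule lborel.borel_measurable_nn_integral) (simp add: case_prod_beta', measurable)
    then show ?thesis by (subst nn_integral_add) (auto simp: nn_integral_cmult_indicator VD[symmetric])
  qed
  also have "\<dots> \<le> ennreal t * (ennreal (T / t + 1) * ?V) + ennreal ((real n - 1) * M) * ?V"
    using orbits by (rule add_right_mono)
  also have "\<dots> = (ennreal t * ennreal (T / t + 1) + ennreal ((real n - 1) * M)) * ?V"
    by (simp add: algebra_simps)
  also have "ennreal t * ennreal (T / t + 1) + ennreal ((real n - 1) * M) = ennreal (T + t + (real n - 1) * M)"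
  proof -
    have "t * (T / t + 1) = T + t" using t by (simp add: field_simps)
    then have "ennreal t * ennreal (T / t + 1) = ennreal (T + t)" using t by (simp flip: ennreal_mult')
    then show ?thesis using T t M n1 by (subst ennreal_plus) auto
  qed
  finally have "ennreal (real n * (M + l - 2 * \<sigma>)) \<le> ennreal (T + t + (real n - 1) * M)"
    using V by (simp add: ennreal_mult_le_mult_iff mult.commute[of _ ?V])
  then have "real n * (M + l - 2 * \<sigma>) \<le> T + t + (real n - 1) * M"
    using T t M n1 by (subst (asm) ennreal_le_iff) auto
  \<comment> \<open>Inserting \<open>T\<close> cancels \<open>M\<close>: it occurs \<open>n\<close>
    times on the left, and \<open>1 + (n - 1)\<close> times on the right.\<close>
  then have "(real n - 1) * l \<le> (2 * real n + 2) * \<sigma> + 3 * t" by (simp add: T_def algebra_simps)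
  also have "\<dots> \<le> (2 * real n + 5) * \<sigma>" using t(2) by (simp add: algebra_simps)
  also have "\<dots> = l / 2" by (rule s)
  finally have "(real n - 1) * l \<le> l / 2" .
  moreover have "1 * l \<le> (real n - 1) * l" using n2 l by (intro mult_right_mono) (auto simp: n_def)
  ultimately show False using l by simp
qed

text \<open>The library's change of variables needs a well-ordered index type, so a finite index type is
  replaced by a copy of itself carrying a well-order.\<close>
typedef 'a ord_copy = "UNIV :: 'a set" by simp

lemma bij_Rep_ord_copy: "bij Rep_ord_copy"
  by (metis Abs_ord_copy_inverse Rep_ord_copy_inverse UNIV_I bijI')

instance ord_copy :: (finite) finite
  by standard (metis bij_Rep_ord_copy bij_betw_finite finite_code)

instantiation ord_copy :: (finite) wellorder
begin

definition less_eq_ord_copy :: "'a ord_copy \<Rightarrow> 'a ord_copy \<Rightarrow> bool" where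
  "x \<le> y \<longleftrightarrow> to_nat (Rep_ord_copy x) \<le> to_nat (Rep_ord_copy y)"

definition less_ord_copy :: "'a ord_copy \<Rightarrow> 'a ord_copy \<Rightarrow> bool" where
  "x < y \<longleftrightarrow> to_nat (Rep_ord_copy x) < to_nat (Rep_ord_copy y)"

instance
proof
  fix x y z :: "'a ord_copy" and P
  show "x < y \<longleftrightarrow> x \<le> y \<and> \<not> y \<le> x" "x \<le> x" "x \<le> y \<Longrightarrow> y \<le> z \<Longrightarrow> x \<le> z" "x \<le> y \<or> y \<le> x"
    by (auto simp: less_eq_ord_copy_def less_ord_copy_def)
  show "x \<le> y \<Longrightarrow> y \<le> x \<Longrightarrow> x = y"
    by (simp add: less_eq_ord_copy_def Rep_ord_copy_inject)
  show "P x" if step: "\<And>x. (\<And>y. y < x \<Longrightarrow> P y) \<Longrightarrow> P x"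
    by (induction x rule: measure_induct_rule[where f="\<lambda>x. to_nat (Rep_ord_copy x)"])
      (use step in \<open>auto simp: less_ord_copy_def\<close>)
qed

end

text \<open>Conjugation by a linear isometry between possibly different spaces; here it serves to
  rename the coordinates.\<close>

lemma ball_conf_conjugate:
  fixes J :: "'a::euclidean_space \<Rightarrow> 'b::euclidean_space"
  assumes c: "ball_conf f g L" and J: "bounded_linear J" "bounded_linear K"
    and n: "\<And>x. norm (J x) = norm x" "\<And>y. norm (K y) = norm y" and JK: "\<And>x. K (J x) = x" "\<And>y. J (K y) = y"
  shows "ball_conf (\<lambda>y. J (f (K y))) (\<lambda>y. J (g (K y))) (\<lambda>y. L (K y))"
  unfolding ball_conf_def
proof (intro conjI ballI)
  have K1: "continuous_on (ball 0 1) K" "K ` ball 0 1 \<subseteq> ball 0 1"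
    using J(2) n by (auto intro: linear_continuous_on)
  show "homeomorphism (ball 0 1) (ball 0 1) (\<lambda>y. J (f (K y))) (\<lambda>y. J (g (K y)))"
  proof (rule homeomorphismI)
    show "continuous_on (ball 0 1) (\<lambda>y. J (f (K y)))" "continuous_on (ball 0 1) (\<lambda>y. J (g (K y)))"
      using K1 by (auto intro!: bounded_linear.continuous_on[OF J(1)]
        continuous_on_compose2[OF ball_confD(8)[OF c]] continuous_on_compose2[OF ball_confD(9)[OF c]])
  qed (use ball_confD(1-4)[OF c] n JK in auto)
  show "continuous_on (ball 0 1) (\<lambda>y. L (K y))"
    using K1 by (intro continuous_on_compose2[OF ball_confD(10)[OF c]])
  fix y :: 'b assume "y \<in> ball 0 1"
  then have y: "norm (K y) < 1" using n by simp
  show "0 < L (K y)" using ball_confD(5)[OF c y] .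
  obtain f' where f': "(f has_derivative f') (at (K y))" "\<And>h. norm (f' h) = L (K y) * norm h"
    using ball_conf_derivative[OF c y] by blast
  have "((\<lambda>y. f (K y)) has_derivative (\<lambda>h. f' (K h))) (at y)"
    using bounded_linear.has_derivative[OF J(2) has_derivative_ident] f'(1) by (rule has_derivative_compose)
  then have "((\<lambda>y. J (f (K y))) has_derivative (\<lambda>h. J (f' (K h)))) (at y)"
    by (rule bounded_linear.has_derivative[OF J(1)])
  then show "\<exists>D. ((\<lambda>y. J (f (K y))) has_derivative D) (at y) \<and> (\<forall>h. norm (D h) = L (K y) * norm h)"
    using f'(2) n by (intro exI[of _ "\<lambda>h. J (f' (K h))"]) simp
qed

lemma schwarz_derivative_ge_1:
  fixes f g :: "real^'n \<Rightarrow> real^'n"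
  assumes c: "ball_conf f g L" and f0: "f 0 = 0" and n: "CARD('n) \<ge> 2"
  shows "1 \<le> L 0"
proof -
  define J :: "real^'n \<Rightarrow> real^('n ord_copy)" where "J v = (\<chi> i. v $ Rep_ord_copy i)" for v
  define K :: "real^('n ord_copy) \<Rightarrow> real^'n" where "K w = (\<chi> i. w $ Abs_ord_copy i)" for w
  have lin: "linear J" "linear K" by (auto simp: linear_iff J_def K_def vec_eq_iff)
  have JK: "K (J x) = x" "J (K y) = y" for x y
    by (simp_all add: J_def K_def vec_eq_iff Abs_ord_copy_inverse Rep_ord_copy_inverse)
  have nJ: "norm (J x) = norm x" for x
  proof -
    have "(\<Sum>i\<in>UNIV. (norm (x $ Rep_ord_copy i))\<^sup>2) = (\<Sum>i\<in>UNIV. (norm (x $ i))\<^sup>2)"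
      using sum.reindex_bij_betw[OF bij_Rep_ord_copy] .
    then show ?thesis by (simp add: norm_vec_def L2_set_def J_def)
  qed
  have nK: "norm (K y) = norm y" for y using nJ[of "K y"] JK by simp
  have "CARD('n ord_copy) = CARD('n)" using bij_betw_same_card[OF bij_Rep_ord_copy] .
  then have "1 \<le> L (K 0)"
    using n f0 lin
    by (intro schwarz_derivative_ge_1_wellorder[OF ball_conf_conjugate[OF c, of J K]])
      (auto simp: nJ nK JK linear_0 linear_conv_bounded_linear[symmetric])
  then show ?thesis using linear_0[OF lin(2)] by simp
qed

text \<open>This is the square of \<open>sinh (\<rho> / 2)\<close> for the hyperbolic distance
  \<open>\<rho>\<close> of the ball.\<close>

definition hyp_ratio :: "'a::euclidean_space \<Rightarrow> 'a \<Rightarrow> real" where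
  "hyp_ratio x y = (dist x y)\<^sup>2 / ((1 - (norm x)\<^sup>2) * (1 - (norm y)\<^sup>2))"

lemma ball_conf_cong:
  assumes c: "ball_conf f g L" and eq: "\<And>x. x \<in> ball 0 1 \<Longrightarrow> L x = L' x"
  shows "ball_conf f g L'"
  unfolding ball_conf_def
proof (intro conjI)
  show "continuous_on (ball 0 1) L'" using continuous_on_eq[OF ball_confD(10)[OF c] eq] .
qed (use c eq in \<open>simp_all add: ball_conf_def\<close>)

text \<open>At \<open>a = 0\<close> the centre of the inversion would lie at infinity, and the
  identity takes over.\<close>

lemma ball_involution:
  fixes a :: "'a::euclidean_space"
  assumes a: "norm a < 1"
  obtains p where "ball_conf p p (\<lambda>x. (1 - (norm (p x))\<^sup>2) / (1 - (norm x)\<^sup>2))" "p a = 0" "p 0 = a"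
    "\<And>x y. norm x < 1 \<Longrightarrow> norm y < 1 \<Longrightarrow> hyp_ratio (p x) (p y) = hyp_ratio x y"
proof (cases "a = 0")
  case True
  have "(norm x)\<^sup>2 < 1" if "norm x < 1" for x :: 'a using that by (simp add: power_less_one_iff)
  then have "(1 - (norm x)\<^sup>2) / (1 - (norm x)\<^sup>2) = 1" if "x \<in> ball 0 1" for x :: 'a using that by force
  then have "ball_conf id id (\<lambda>x :: 'a. (1 - (norm (id x))\<^sup>2) / (1 - (norm x)\<^sup>2))"
    by (intro ball_conf_cong[OF ball_conf_id]) simp
  then show ?thesis using True by (intro that[of id]) auto
next
  case False
  note c = sph_inv_center[OF False a]
  show ?thesis
    using sph_inv_hyperbolic[OF c(1)] by (intro that[OF sph_inv_ball_conf[OF c(1)] c(2,3)]) (simp add: hyp_ratio_def)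
qed

text \<open>With involutions satisfying \<open>p 0 = a\<close> and \<open>q (f a) = 0\<close>, the
  map \<open>q \<circ> f \<circ> p\<close> fixes 0. Its dilation there is
  \<open>L a * (1 - |a|^2) / (1 - |f a|^2)\<close>, which is at least 1.\<close>

lemma ball_conf_factor_ge:
  fixes f :: "real^'n \<Rightarrow> real^'n"
  assumes c: "ball_conf f g L" and n: "CARD('n) \<ge> 2" and a: "norm a < 1"
  shows "1 - (norm (f a))\<^sup>2 \<le> L a * (1 - (norm a)\<^sup>2)"
proof -
  have fa: "norm (f a) < 1" using ball_confD(1)[OF c a] .
  obtain p where p: "ball_conf p p (\<lambda>x. (1 - (norm (p x))\<^sup>2) / (1 - (norm x)\<^sup>2))" "p 0 = a"
    by (rule ball_involution[OF a]) blast
  obtain q where q: "ball_conf q q (\<lambda>x. (1 - (norm (q x))\<^sup>2) / (1 - (norm x)\<^sup>2))" "q (f a) = 0"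
    by (rule ball_involution[OF fa]) blast
  note F = ball_conf_compose[OF ball_conf_compose[OF p(1) c] q(1)]
  have "1 \<le> (1 - (norm (q ((f \<circ> p) 0)))\<^sup>2) / (1 - (norm ((f \<circ> p) 0))\<^sup>2) * (L (p 0) * ((1 - (norm (p 0))\<^sup>2) / (1 - (norm (0 :: real^'n))\<^sup>2)))"
    by (rule schwarz_derivative_ge_1[OF F _ n]) (simp add: p q)
  then have "1 \<le> 1 / (1 - (norm (f a))\<^sup>2) * (L a * (1 - (norm a)\<^sup>2))" by (simp add: p q)
  moreover have "0 < 1 - (norm (f a))\<^sup>2" using fa by (simp add: power_less_one_iff)
  ultimately show ?thesis by (simp add: field_simps)
qed

text \<open>The inverse map at \<open>f a\<close> supplies the reverse inequality. So
  \<open>f\<close> preserves the hyperbolic length element.\<close>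

lemma ball_conf_factor:
  fixes f :: "real^'n \<Rightarrow> real^'n"
  assumes c: "ball_conf f g L" and n: "CARD('n) \<ge> 2" and a: "norm a < 1"
  shows "L a * (1 - (norm a)\<^sup>2) = 1 - (norm (f a))\<^sup>2"
proof (rule antisym)
  have "1 - (norm (g (f a)))\<^sup>2 \<le> inverse (L (g (f a))) * (1 - (norm (f a))\<^sup>2)"
    by (rule ball_conf_factor_ge[OF ball_conf_inverse[OF c] n ball_confD(1)[OF c a]])
  then show "L a * (1 - (norm a)\<^sup>2) \<le> 1 - (norm (f a))\<^sup>2"
    using ball_confD(3,5)[OF c a] by (simp add: field_simps)
qed (rule ball_conf_factor_ge[OF c n a])

text \<open>\<open>artanh |z|\<close> is half the hyperbolic distance of \<open>z\<close> from 0.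
  Along a radius that of the image grows no faster, as \<open>f\<close> preserves the length
  element, and both start at 0.\<close>

lemma ball_conf_norm_le:
  fixes f :: "real^'n \<Rightarrow> real^'n"
  assumes c: "ball_conf f g L" and f0: "f 0 = 0" and n: "CARD('n) \<ge> 2" and z: "norm z < 1"
  shows "norm (f z) \<le> norm z"
proof (cases "z = 0")
  case False
  have t1: "norm (t *\<^sub>R z) < 1" if "0 \<le> t" "t \<le> 1" for t
  proof -
    have "t * norm z \<le> 1 * norm z" using that by (intro mult_right_mono) auto
    also have "\<dots> < 1" using z by simp
    finally show ?thesis using that by simp
  qed
  have ft: "norm (f (t *\<^sub>R z)) < 1" if "0 \<le> t" "t \<le> 1" for t using ball_confD(1)[OF c t1[OF that]] .
  have cont: "continuous_on {0..1} (\<lambda>t. f (t *\<^sub>R z))"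
    by (rule continuous_on_compose2[OF ball_confD(8)[OF c]]) (use t1 in \<open>auto intro!: continuous_intros\<close>)
  define F where "F t = artanh (norm (f (t *\<^sub>R z))) - artanh (t * norm z)" for t
  have "F 1 \<le> F 0"
  proof (rule DERIV_nonpos_imp_decreasing_open[of 0 1])
    show "continuous_on {0..1} F"
      unfolding F_def using ft t1 by (intro continuous_intros cont) (force simp: less_le_trans[of "-1" 0])+
  next
    fix t :: real assume t: "0 < t" "t < 1"
    then have t': "0 \<le> t" "t \<le> 1" by auto
    let ?y = "t *\<^sub>R z"
    have y: "norm ?y < 1" "?y \<noteq> 0" using t1[OF t'] t False by auto
    have "((\<lambda>t. t *\<^sub>R z) has_vector_derivative z) (at t)"
      by (auto intro!: derivative_eq_intros simp: has_vector_derivative_def)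
    then obtain d where d: "((\<lambda>t. norm (f (t *\<^sub>R z))) has_real_derivative d) (at t)" "\<bar>d\<bar> \<le> L ?y * norm z"
      using ball_conf_has_derivative_norm_path[OF c f0, of "\<lambda>t. t *\<^sub>R z" z t] y by blast
    have pos: "0 < 1 - (norm (f ?y))\<^sup>2" "0 < 1 - (norm ?y)\<^sup>2"
      using ft[OF t'] y by (simp_all add: power_less_one_iff)
    have "(F has_real_derivative (1 / (1 - (norm (f ?y))\<^sup>2) * d - 1 / (1 - (t * norm z)\<^sup>2) * norm z)) (at t)"
      unfolding F_def using ft[OF t'] y t
      by (auto intro!: derivative_eq_intros d(1) DERIV_chain2[OF artanh_real_has_field_derivative])
    moreover have "1 / (1 - (norm (f ?y))\<^sup>2) * d \<le> 1 / (1 - (t * norm z)\<^sup>2) * norm z"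
    proof -
      have "d / (1 - (norm (f ?y))\<^sup>2) \<le> L ?y * norm z / (1 - (norm (f ?y))\<^sup>2)"
        using d(2) pos by (intro divide_right_mono) auto
      also have "\<dots> = norm z / (1 - (norm ?y)\<^sup>2)"
        using pos ball_confD(5)[OF c y(1)] by (simp flip: ball_conf_factor[OF c n y(1)])
      finally show ?thesis using t by simp
    qed
    ultimately show "\<exists>y. (F has_real_derivative y) (at t) \<and> y \<le> 0" by (metis diff_le_0_iff_le)
  qed simp
  then have "artanh (norm (f z)) \<le> artanh (norm z)" by (simp add: F_def f0)
  then have "ln ((1 + norm (f z)) / (1 - norm (f z))) \<le> ln ((1 + norm z) / (1 - norm z))" by (simp add: artanh_def)
  moreover have "0 < (1 + norm (f z)) / (1 - norm (f z))" "0 < (1 + norm z) / (1 - norm z)"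
    using z ball_confD(1)[OF c z] by (auto intro!: divide_pos_pos add_pos_nonneg)
  ultimately have "(1 + norm (f z)) / (1 - norm (f z)) \<le> (1 + norm z) / (1 - norm z)" by simp
  then show ?thesis using z ball_confD(1)[OF c z] by (simp add: field_simps)
qed (simp add: f0)

lemma ball_conf_norm_eq:
  fixes f :: "real^'n \<Rightarrow> real^'n"
  assumes c: "ball_conf f g L" and f0: "f 0 = 0" and n: "CARD('n) \<ge> 2" and z: "norm z < 1"
  shows "norm (f z) = norm z"
proof (rule antisym)
  have "g 0 = 0" using ball_confD(3)[OF c, of 0] f0 by simp
  then have "norm (g (f z)) \<le> norm (f z)"
    by (rule ball_conf_norm_le[OF ball_conf_inverse[OF c] _ n ball_confD(1)[OF c z]])
  then show "norm z \<le> norm (f z)" using ball_confD(3)[OF c z] by simp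
qed (rule ball_conf_norm_le[OF assms])

text \<open>Involutions move \<open>x\<close> and \<open>f x\<close> to 0. The conjugated map fixes
  0 and preserves norms, and \<open>hyp_ratio 0 z\<close> depends on \<open>|z|\<close>
  only.\<close>

lemma ball_conf_hyp_ratio:
  fixes f :: "real^'n \<Rightarrow> real^'n"
  assumes c: "ball_conf f g L" and n: "CARD('n) \<ge> 2" and x: "norm x < 1" and y: "norm y < 1"
  shows "hyp_ratio (f x) (f y) = hyp_ratio x y"
proof -
  have fx: "norm (f x) < 1" "norm (f y) < 1" using ball_confD(1)[OF c] x y by auto
  obtain p where p: "ball_conf p p (\<lambda>x. (1 - (norm (p x))\<^sup>2) / (1 - (norm x)\<^sup>2))" "p x = 0" "p 0 = x"
    "hyp_ratio (p x) (p y) = hyp_ratio x y"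
    using x y by - (rule ball_involution[OF x], blast)
  obtain q where q: "ball_conf q q (\<lambda>x. (1 - (norm (q x))\<^sup>2) / (1 - (norm x)\<^sup>2))" "q (f x) = 0"
    "hyp_ratio (q (f x)) (q (f y)) = hyp_ratio (f x) (f y)"
    using fx by - (rule ball_involution[OF fx(1)], blast)
  have "norm ((q \<circ> (f \<circ> p)) (p y)) = norm (p y)"
    by (rule ball_conf_norm_eq[OF ball_conf_compose[OF ball_conf_compose[OF p(1) c] q(1)] _ n])
      (use p q ball_confD(1)[OF p(1) y] in simp_all)
  then have "norm (q (f y)) = norm (p y)" using ball_confD(3)[OF p(1) y] by simp
  then have "hyp_ratio 0 (q (f y)) = hyp_ratio 0 (p y)" by (simp add: hyp_ratio_def)
  then show ?thesis using p q by simp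
qed

section \<open>Inequalities for a pair of points in the ball\<close>

lemma quadratic_pos: "0 < 1 - 2 * u + 2 * u\<^sup>2" if "u < 1" for u :: real
proof -
  have "1 - 2 * u + 2 * u\<^sup>2 = (1 - u)\<^sup>2 + u\<^sup>2" by algebra
  also have "\<dots> > 0" using that by (intro add_pos_nonneg) auto
  finally show ?thesis .
qed

text \<open>Here \<open>a, b, D\<close> stand for \<open>|x|, |y|, |x - y|\<close>, while \<open>N\<close> stands for \<open>|x + y|\<close> and
  \<open>D / A\<close> is \<open>tanh\<close> of half the hyperbolic distance.\<close>
locale ball_triangle =
  fixes a b D A :: real
  assumes a: "0 \<le> a" "a < 1" and b: "0 \<le> b" "b < 1"
    and D: "\<bar>a - b\<bar> \<le> D" "D \<le> a + b"
    and A: "0 \<le> A" "A\<^sup>2 = D\<^sup>2 + (1 - a\<^sup>2) * (1 - b\<^sup>2)"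
begin

lemma swap: "ball_triangle b a D A"
proof (rule ball_triangle.intro[OF b a])
  show "\<bar>b - a\<bar> \<le> D" using D(1) by (simp only: abs_minus_commute)
  show "D \<le> b + a" using D(2) by (simp only: add.commute)
  show "A\<^sup>2 = D\<^sup>2 + (1 - b\<^sup>2) * (1 - a\<^sup>2)" using A(2) by (simp only: mult.commute)
qed (rule A(1))

text \<open>The extremes belong to collinear points: \<open>A\<close> equals
  \<open>1 - a * b\<close> for \<open>D = |a - b|\<close> and \<open>1 + a * b\<close> for
  \<open>D = a + b\<close>.\<close>

lemma A_bounds: "1 - a * b \<le> A" "A \<le> 1 + a * b"
proof -
  have "(a - b)\<^sup>2 \<le> D\<^sup>2" using D(1) by (metis abs_ge_zero power2_abs power_mono)
  then have "(1 - a * b)\<^sup>2 \<le> A\<^sup>2" unfolding A(2) by (simp add: power2_eq_square algebra_simps)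
  then show "1 - a * b \<le> A" using A(1) by (rule power2_le_imp_le)
  have "D\<^sup>2 \<le> (a + b)\<^sup>2" using D by (intro power_mono) auto
  then have "A\<^sup>2 \<le> (1 + a * b)\<^sup>2" unfolding A(2) by (simp add: power2_eq_square algebra_simps)
  then show "A \<le> 1 + a * b" by (rule power2_le_imp_le) (use a b in simp)
qed

lemma A_pos: "0 < A"
proof -
  have "a * b < 1 * 1" using a b by (intro mult_strict_mono') auto
  then show ?thesis using A_bounds(1) by simp
qed

text \<open>From \<open>(A - D) * (A + D) = (1 - a^2) * (1 - b^2)\<close> and
  \<open>A + D \<le> (1 + a) * (1 + b)\<close> comes \<open>A - D \<ge> (1 - a) * (1 - b)\<close>.
  Adding \<open>A \<ge> 1 - a * b\<close> gives the claim.\<close>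

lemma D_plus_gaps_le: "D + (1 - a) + (1 - b) \<le> 2 * A"
proof -
  have "A + D \<le> (1 + a) * (1 + b)" using A_bounds(2) D(2) by (simp add: algebra_simps)
  moreover have DA: "D \<le> A"
  proof (rule power2_le_imp_le)
    have "0 \<le> (1 - a\<^sup>2) * (1 - b\<^sup>2)" using a b by (intro mult_nonneg_nonneg) (auto simp: power_le_one)
    then show "D\<^sup>2 \<le> A\<^sup>2" unfolding A(2) by simp
  qed (rule A)
  ultimately have "(A - D) * (A + D) \<le> (A - D) * ((1 + a) * (1 + b))" by (intro mult_left_mono) auto
  moreover have "(A - D) * (A + D) = ((1 - a) * (1 - b)) * ((1 + a) * (1 + b))"
    using A(2) by (simp add: power2_eq_square algebra_simps)
  moreover have "0 < (1 + a) * (1 + b)" using a b by simp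
  ultimately have "(1 - a) * (1 - b) \<le> A - D" using mult_le_cancel_right_pos by metis
  then show ?thesis using A_bounds(1) by (simp add: algebra_simps)
qed

text \<open>For fixed \<open>a\<close> and \<open>b\<close>, \<open>A\<close> is a convex function
  of \<open>D\<close>. The right side is its chord between \<open>D = a - b\<close> and
  \<open>D = a + b\<close>.\<close>

lemma A_le_affine: "A \<le> 1 - a\<^sup>2 + a * D"
proof (rule power2_le_imp_le)
  have "0 \<le> (1 - a\<^sup>2) * ((b - a + D) * (b + a - D))"
    using a b D by (intro mult_nonneg_nonneg) (auto simp: power_le_one)
  also have "\<dots> = (1 - a\<^sup>2 + a * D)\<^sup>2 - A\<^sup>2" unfolding A(2) by algebra
  finally show "A\<^sup>2 \<le> (1 - a\<^sup>2 + a * D)\<^sup>2" by simp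
  show "0 \<le> 1 - a\<^sup>2 + a * D" using a D by (auto simp: power_le_one)
qed

lemma A_le_gap: 
  assumes "a \<le> u"
  shows "A \<le> (1 + u) / 2 * (D + 2 * (1 - a))"
proof -
  have "0 \<le> (1 - a) * D" using a D by auto
  then have "1 - a\<^sup>2 + a * D \<le> (1 + a) / 2 * (D + 2 * (1 - a))"
    by (simp add: power2_eq_square field_simps)
  also have "\<dots> \<le> (1 + u) / 2 * (D + 2 * (1 - a))"
    using assms a D by (intro mult_right_mono) auto
  finally show ?thesis using A_le_affine by linarith
qed

lemma A_le_min_gap:
  assumes "a \<le> u" "b \<le> u"
  shows "A \<le> (1 + u) / 2 * (D + 2 * min (1 - a) (1 - b))"
proof (cases "1 - a \<le> 1 - b")
  case True
  then show ?thesis using A_le_gap[OF assms(1)] by (simp only: min_def if_True)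
next
  case False
  then show ?thesis using ball_triangle.A_le_gap[OF swap assms(2)] by (simp only: min_def if_False)
qed

lemma A_le_gaps:
  assumes "a \<le> u" "b \<le> u"
  shows "A \<le> (1 + u) / 2 * (D + (1 - a) + (1 - b))"
proof -
  have "(1 + u) / 2 * (D + 2 * min (1 - a) (1 - b)) \<le> (1 + u) / 2 * (D + (1 - a) + (1 - b))"
    using a assms by (intro mult_left_mono) (auto simp: min_def)
  then show ?thesis using A_le_min_gap[OF assms] by linarith
qed

text \<open>Cauchy-Schwarz for \<open>(1 + l, 2)\<close> and \<open>(D, E)\<close>, where
  \<open>E^2 \<le> (1 - a^2) * (1 - b^2)\<close>. The constant is the squared length
  \<open>(1 + l)^2 + 4 = 5 + 2 * l + l^2\<close>.\<close>

lemma min_gap_le_A: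
  assumes l: "0 \<le> l" "l \<le> a" "l \<le> b"
  shows "(1 + l) / sqrt (5 + 2 * l + l\<^sup>2) * (D + 2 * min (1 - a) (1 - b)) \<le> A"
proof -
  define E where "E = (1 + l) * min (1 - a) (1 - b)"
  have E0: "0 \<le> E" using l a b by (simp add: E_def)
  have k: "0 < 5 + 2 * l + l\<^sup>2" using l by (simp add: add_pos_nonneg)
  have "E * E \<le> ((1 + a) * (1 - a)) * ((1 + b) * (1 - b))"
    unfolding E_def using l a b by (intro mult_mono) auto
  then have E: "E\<^sup>2 \<le> (1 - a\<^sup>2) * (1 - b\<^sup>2)" by (simp add: power2_eq_square algebra_simps)
  have "((1 + l) * D + 2 * E)\<^sup>2 = (5 + 2 * l + l\<^sup>2) * (D\<^sup>2 + E\<^sup>2) - (2 * D - (1 + l) * E)\<^sup>2" by algebra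
  also have "\<dots> \<le> (5 + 2 * l + l\<^sup>2) * (D\<^sup>2 + E\<^sup>2)" by simp
  also have "\<dots> \<le> (5 + 2 * l + l\<^sup>2) * A\<^sup>2" unfolding A(2) using E k by (intro mult_left_mono) auto
  also have "\<dots> = (sqrt (5 + 2 * l + l\<^sup>2) * A)\<^sup>2" using k by (simp add: power_mult_distrib)
  finally have "(1 + l) * D + 2 * E \<le> sqrt (5 + 2 * l + l\<^sup>2) * A"
    by (rule power2_le_imp_le) (use A(1) k in simp)
  then show ?thesis using k by (simp add: E_def field_simps)
qed

lemma root_gaps_le_A:
  assumes l: "0 \<le> l" "l \<le> a" "l \<le> b"
  shows "(1 + l) / 2 * sqrt (D\<^sup>2 + 4 * (1 - a) * (1 - b)) \<le> A"
proof (rule power2_le_imp_le)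
  have X: "0 \<le> D\<^sup>2 + 4 * (1 - a) * (1 - b)" using a b by simp
  have 1: "(1 + l)\<^sup>2 \<le> 2\<^sup>2" using l a by (intro power_mono) auto
  have 2: "(1 + l) * (1 + l) \<le> (1 + a) * (1 + b)" using l a by (intro mult_mono) auto
  have "(1 + l)\<^sup>2 * D\<^sup>2 \<le> 2\<^sup>2 * D\<^sup>2" using 1 by (rule mult_right_mono) simp
  moreover have "(1 + l) * (1 + l) * ((1 - a) * (1 - b)) \<le> (1 + a) * (1 + b) * ((1 - a) * (1 - b))"
    using 2 a b by (intro mult_right_mono) auto
  ultimately have "(1 + l)\<^sup>2 * (D\<^sup>2 + 4 * (1 - a) * (1 - b)) \<le> 4 * A\<^sup>2"
    unfolding A(2) by (simp add: power2_eq_square algebra_simps)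
  then show "((1 + l) / 2 * sqrt (D\<^sup>2 + 4 * (1 - a) * (1 - b)))\<^sup>2 \<le> A\<^sup>2"
    using X by (simp add: power_mult_distrib power_divide)
qed (rule A)

text \<open>Equality holds for \<open>a = b\<close>, \<open>D = 2 * a\<close>, that is
  \<open>y = - x\<close>, which explains the constant. The difference of the sides decreases in
  \<open>D^2\<close>, with coefficient \<open>(1 - a)^3 * (a + 3)\<close>, so the worst case is
  \<open>D = a + b\<close>.\<close>

lemma A_le_root_gaps_max:
  assumes ba: "b \<le> a"
  shows "4 * (1 - 2 * a + 2 * a\<^sup>2) * A\<^sup>2 \<le> (1 + a\<^sup>2)\<^sup>2 * (D\<^sup>2 + 4 * (1 - a) * (1 - b))"
proof -
  \<comment> \<open>At \<open>D = a + b\<close> the difference of the sides is quadratic in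
    \<open>b\<close> with root \<open>a\<close>; it factors as \<open>(a - b) * (w - c * b)\<close>.
    The linear factor is checked at an end of \<open>0 \<le> b \<le> a\<close>, according to the
    sign of \<open>c\<close>.\<close>
  define w where "w = (1 - a) * (4 + 5 * a - 3 * a\<^sup>2 + 3 * a^3 - a^4)"
  define c where "c = 1 - 2 * a\<^sup>2 + 8 * a^3 - 7 * a^4"
  have "0 \<le> w - c * b"
  proof (cases "c \<le> 0")
    case True
    have "a\<^sup>2 \<le> 1" "a^4 \<le> a^3" using a by (auto simp: power_le_one intro!: power_decreasing)
    moreover have "0 \<le> a^3" "0 \<le> a" using a by simp_all
    ultimately have "0 \<le> 4 + 5 * a - 3 * a\<^sup>2 + 3 * a^3 - a^4" by linarith
    then have "0 \<le> w" using a unfolding w_def by (intro mult_nonneg_nonneg) auto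
    moreover have "c * b \<le> 0" using True b by (simp add: mult_nonpos_nonneg)
    ultimately show ?thesis by simp
  next
    case False
    then have "c * b \<le> c * a" using ba by (intro mult_left_mono) auto
    moreover have "w - c * a = 4 * (1 - a)\<^sup>2 * (1 + 2 * a + a\<^sup>2 + 2 * a^3)"
      unfolding w_def c_def by algebra
    moreover have "0 \<le> 4 * (1 - a)\<^sup>2 * (1 + 2 * a + a\<^sup>2 + 2 * a^3)" using a by simp
    ultimately show ?thesis by simp
  qed
  then have 1: "0 \<le> (a - b) * (w - c * b)" using ba by simp
  have "0 \<le> (1 - a)^3 * (a + 3) * ((a + b)\<^sup>2 - D\<^sup>2)"
    using a D by (intro mult_nonneg_nonneg) (auto intro!: power_mono)
  also have "\<dots> = (1 + a\<^sup>2)\<^sup>2 * (D\<^sup>2 + 4 * (1 - a) * (1 - b)) - 4 * (1 - 2 * a + 2 * a\<^sup>2) * A\<^sup>2 - (a - b) * (w - c * b)"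
    unfolding A(2) w_def c_def by algebra
  finally show ?thesis using 1 by linarith
qed

text \<open>Passes from \<open>a\<close> to \<open>u\<close>, since
  \<open>(1 + u^2)^2 / (1 - 2 * u + 2 * u^2)\<close> increases on the unit interval; the explicit
  polynomial in the proof is the certificate.\<close>

lemma A_le_root_gaps_aux:
  assumes ba: "b \<le> a" and u: "a \<le> u" "u < 1"
  shows "4 * (1 - 2 * u + 2 * u\<^sup>2) * A\<^sup>2 \<le> (1 + u\<^sup>2)\<^sup>2 * (D\<^sup>2 + 4 * (1 - a) * (1 - b))"
proof -
  define X where "X = D\<^sup>2 + 4 * (1 - a) * (1 - b)"
  have X: "0 \<le> X" using a b by (simp add: X_def)
  have Q: "0 < 1 - 2 * u + 2 * u\<^sup>2" "0 < 1 - 2 * a + 2 * a\<^sup>2" using quadratic_pos u a by auto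
  have "0 \<le> (u - a) * (2 * (1 - u * a)\<^sup>2 + (u + a) * ((u - a)\<^sup>2 + 2 * (u * a) * ((1 - u) * (1 - a))))"
    using a u by (intro mult_nonneg_nonneg add_nonneg_nonneg) auto
  also have "\<dots> = (1 + u\<^sup>2)\<^sup>2 * (1 - 2 * a + 2 * a\<^sup>2) - (1 + a\<^sup>2)\<^sup>2 * (1 - 2 * u + 2 * u\<^sup>2)" by algebra
  finally have mono: "(1 + a\<^sup>2)\<^sup>2 * (1 - 2 * u + 2 * u\<^sup>2) \<le> (1 + u\<^sup>2)\<^sup>2 * (1 - 2 * a + 2 * a\<^sup>2)" by simp
  have "(1 - 2 * a + 2 * a\<^sup>2) * (4 * (1 - 2 * u + 2 * u\<^sup>2) * A\<^sup>2)
      = (1 - 2 * u + 2 * u\<^sup>2) * (4 * (1 - 2 * a + 2 * a\<^sup>2) * A\<^sup>2)" by (simp only: mult_ac)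
  also have "\<dots> \<le> (1 - 2 * u + 2 * u\<^sup>2) * ((1 + a\<^sup>2)\<^sup>2 * X)"
    using A_le_root_gaps_max[OF ba] Q(1) unfolding X_def by (intro mult_left_mono) auto
  also have "\<dots> = ((1 + a\<^sup>2)\<^sup>2 * (1 - 2 * u + 2 * u\<^sup>2)) * X" by (simp only: mult_ac)
  also have "\<dots> \<le> ((1 + u\<^sup>2)\<^sup>2 * (1 - 2 * a + 2 * a\<^sup>2)) * X" using mono X by (rule mult_right_mono)
  also have "\<dots> = (1 - 2 * a + 2 * a\<^sup>2) * ((1 + u\<^sup>2)\<^sup>2 * X)" by (simp only: mult_ac)
  finally show ?thesis using Q(2) unfolding X_def by (simp only: mult_le_cancel_left_pos)
qed

lemma A_le_root_gaps:
  assumes u: "a \<le> u" "b \<le> u" "u < 1"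
  shows "A \<le> (1 + u\<^sup>2) / (2 * sqrt (1 - 2 * u + 2 * u\<^sup>2)) * sqrt (D\<^sup>2 + 4 * (1 - a) * (1 - b))"
proof -
  have Q: "0 < 1 - 2 * u + 2 * u\<^sup>2" by (rule quadratic_pos[OF u(3)])
  have X: "0 \<le> D\<^sup>2 + 4 * (1 - a) * (1 - b)" using a b by simp
  have "4 * (1 - 2 * u + 2 * u\<^sup>2) * A\<^sup>2 \<le> (1 + u\<^sup>2)\<^sup>2 * (D\<^sup>2 + 4 * (1 - a) * (1 - b))"
  proof (cases "b \<le> a")
    case True
    then show ?thesis by (rule A_le_root_gaps_aux) (use u in auto)
  next
    case False
    then have "a \<le> b" by simp
    have "4 * (1 - b) * (1 - a) = 4 * (1 - a) * (1 - b)" by (simp only: mult_ac)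
    with ball_triangle.A_le_root_gaps_aux[OF swap \<open>a \<le> b\<close> u(2,3)] show ?thesis by (simp only:)
  qed
  then have "(2 * sqrt (1 - 2 * u + 2 * u\<^sup>2) * A)\<^sup>2 \<le> ((1 + u\<^sup>2) * sqrt (D\<^sup>2 + 4 * (1 - a) * (1 - b)))\<^sup>2"
    using Q X by (simp add: power_mult_distrib)
  then have "2 * sqrt (1 - 2 * u + 2 * u\<^sup>2) * A \<le> (1 + u\<^sup>2) * sqrt (D\<^sup>2 + 4 * (1 - a) * (1 - b))"
    by (rule power2_le_imp_le) (use X in simp)
  then show ?thesis using Q by (simp add: field_simps)
qed

text \<open>By the parallelogram law \<open>A^2 = (1 + a^2) * (1 + b^2) - N^2\<close>, so the
  difference of the sides is a concave quadratic in \<open>N\<close>. It is clearly nonnegative up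
  to \<open>N = 1 + b^2\<close> and decreases beyond, so there \<open>N = a + b\<close> is the worst
  case.\<close>

lemma barrlund_le_A_aux:
  assumes N: "0 \<le> N" "N \<le> a + b" "N\<^sup>2 = 2 * a\<^sup>2 + 2 * b\<^sup>2 - D\<^sup>2" and ba: "b \<le> a"
  shows "(1 + b\<^sup>2) * (2 + a\<^sup>2 + b\<^sup>2 - 2 * N) \<le> 2 * A\<^sup>2"
proof -
  have f: "2 * A\<^sup>2 - (1 + b\<^sup>2) * (2 + a\<^sup>2 + b\<^sup>2 - 2 * N) = (1 + b\<^sup>2) * (a\<^sup>2 - b\<^sup>2) + 2 * (N * (1 + b\<^sup>2 - N))"
    unfolding A(2) using N(3) by algebra
  have f0: "0 \<le> (1 + b\<^sup>2) * (a\<^sup>2 - b\<^sup>2)" using ba b by (intro mult_nonneg_nonneg) (auto intro: power_mono)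
  show ?thesis
  proof (cases "N \<le> 1 + b\<^sup>2")
    case True
    then have "0 \<le> N * (1 + b\<^sup>2 - N)" using N by simp
    then show ?thesis using f f0 by linarith
  next
    case False
    define S where "S = a + b"
    have "0 \<le> (S - N) * (S + N - (1 + b\<^sup>2))" using False N by (intro mult_nonneg_nonneg) (auto simp: S_def)
    also have "\<dots> = N * (1 + b\<^sup>2 - N) - S * (1 + b\<^sup>2 - S)" by algebra
    finally have 1: "S * (1 + b\<^sup>2 - S) \<le> N * (1 + b\<^sup>2 - N)" by simp
    have "(1 - a)\<^sup>2 \<le> (1 - b)\<^sup>2" using ba a by (intro power_mono) auto
    then have "0 \<le> (1 - b) * (4 * (1 - a) * b + (1 + b) * ((1 - b)\<^sup>2 - (1 - a)\<^sup>2))"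
      using a b by (intro mult_nonneg_nonneg add_nonneg_nonneg) auto
    also have "\<dots> = (1 + b\<^sup>2) * (a\<^sup>2 - b\<^sup>2) + 2 * (S * (1 + b\<^sup>2 - S))" unfolding S_def by algebra
    finally show ?thesis using f 1 by linarith
  qed
qed

text \<open>Because \<open>S + N \<le> 4 * a \<le> (1 + a)^2\<close>, the difference of the sides is
  smallest at \<open>N = S\<close>. This is the case of points on a common ray, where
  \<open>A = 1 - a * b\<close>.\<close>

lemma A_le_barrlund_aux:
  assumes N: "0 \<le> N" "N \<le> a + b" "N\<^sup>2 = 2 * a\<^sup>2 + 2 * b\<^sup>2 - D\<^sup>2" and ba: "b \<le> a"
  shows "2 * A\<^sup>2 \<le> (1 + a)\<^sup>2 * (2 + a\<^sup>2 + b\<^sup>2 - 2 * N)"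
proof -
  define S where "S = a + b"
  have "(1 + a)\<^sup>2 = 4 * a + (1 - a)\<^sup>2" by algebra
  then have "4 * a \<le> (1 + a)\<^sup>2" by simp
  then have "0 \<le> 2 * ((S - N) * ((1 + a)\<^sup>2 - S - N))"
    using N ba unfolding S_def by (intro mult_nonneg_nonneg) auto
  moreover have "2 * ((S - N) * ((1 + a)\<^sup>2 - S - N)) = (1 + a)\<^sup>2 * (2 + a\<^sup>2 + b\<^sup>2 - 2 * N) - 2 * A\<^sup>2
      - ((1 + a)\<^sup>2 * ((1 - a)\<^sup>2 + (1 - b)\<^sup>2) - 2 * (1 - a * b)\<^sup>2)"
    unfolding A(2) S_def using N(3) by algebra
  moreover have "2 * (1 - a * b)\<^sup>2 \<le> (1 + a)\<^sup>2 * ((1 - a)\<^sup>2 + (1 - b)\<^sup>2)"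
  proof -
    have "0 \<le> (a - b) * (1 - a)" using ba a by simp
    then have "2 * (1 - a * b) \<le> (1 + a) * (2 - a - b)" by (simp add: algebra_simps)
    moreover have "a * b \<le> 1" using a b by (simp add: mult_le_one)
    ultimately have "(2 * (1 - a * b))\<^sup>2 \<le> ((1 + a) * (2 - a - b))\<^sup>2" by (intro power_mono) auto
    also have "\<dots> = 2 * ((1 + a)\<^sup>2 * ((1 - a)\<^sup>2 + (1 - b)\<^sup>2)) - ((1 + a) * (a - b))\<^sup>2" by algebra
    also have "\<dots> \<le> 2 * ((1 + a)\<^sup>2 * ((1 - a)\<^sup>2 + (1 - b)\<^sup>2))" by simp
    finally have "4 * (1 - a * b)\<^sup>2 \<le> 2 * ((1 + a)\<^sup>2 * ((1 - a)\<^sup>2 + (1 - b)\<^sup>2))"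
      unfolding power_mult_distrib by simp
    then show ?thesis by linarith
  qed
  ultimately show ?thesis by linarith
qed

lemma barrlund_denominator_pos:
  assumes "N \<le> a + b"
  shows "0 < 2 + a\<^sup>2 + b\<^sup>2 - 2 * N"
proof -
  have "0 < (1 - a)\<^sup>2 + (1 - b)\<^sup>2" using a by (intro add_pos_nonneg) auto
  also have "\<dots> = 2 + a\<^sup>2 + b\<^sup>2 - 2 * (a + b)" by algebra
  finally have "0 < 2 + a\<^sup>2 + b\<^sup>2 - 2 * (a + b)" .
  moreover have "2 * N \<le> 2 * (a + b)" using assms by simp
  ultimately show ?thesis by linarith
qed

lemma barrlund_le_A:
  assumes N: "0 \<le> N" "N \<le> a + b" "N\<^sup>2 = 2 * a\<^sup>2 + 2 * b\<^sup>2 - D\<^sup>2" and l: "0 \<le> l" "l \<le> a" "l \<le> b"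
  shows "sqrt (1 + l\<^sup>2) / sqrt 2 * sqrt (2 + a\<^sup>2 + b\<^sup>2 - 2 * N) \<le> A"
proof -
  let ?B = "2 + a\<^sup>2 + b\<^sup>2 - 2 * N"
  have B: "0 < ?B" using barrlund_denominator_pos[OF N(2)] .
  have l2: "l\<^sup>2 \<le> a\<^sup>2" "l\<^sup>2 \<le> b\<^sup>2" using l by (auto intro: power_mono)
  have "(1 + l\<^sup>2) * ?B \<le> 2 * A\<^sup>2"
  proof (cases "b \<le> a")
    case True
    have "(1 + l\<^sup>2) * ?B \<le> (1 + b\<^sup>2) * ?B" using l2 B by (intro mult_right_mono) auto
    then show ?thesis using barrlund_le_A_aux[OF N True] by linarith
  next
    case False
    have "(1 + l\<^sup>2) * ?B \<le> (1 + a\<^sup>2) * ?B" using l2 B by (intro mult_right_mono) auto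
    moreover have "(1 + a\<^sup>2) * (2 + b\<^sup>2 + a\<^sup>2 - 2 * N) \<le> 2 * A\<^sup>2"
      by (rule ball_triangle.barrlund_le_A_aux[OF swap]) (use N False in auto)
    ultimately show ?thesis by (simp add: add_ac)
  qed
  then have "(sqrt (1 + l\<^sup>2) * sqrt ?B)\<^sup>2 \<le> (sqrt 2 * A)\<^sup>2"
    using B by (simp add: power_mult_distrib)
  then have "sqrt (1 + l\<^sup>2) * sqrt ?B \<le> sqrt 2 * A" by (rule power2_le_imp_le) (use A(1) in simp)
  then show ?thesis by (simp add: field_simps)
qed

lemma A_le_barrlund:
  assumes N: "0 \<le> N" "N \<le> a + b" "N\<^sup>2 = 2 * a\<^sup>2 + 2 * b\<^sup>2 - D\<^sup>2" and u: "a \<le> u" "b \<le> u"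
  shows "A \<le> (1 + u) / sqrt 2 * sqrt (2 + a\<^sup>2 + b\<^sup>2 - 2 * N)"
proof -
  let ?B = "2 + a\<^sup>2 + b\<^sup>2 - 2 * N"
  have B: "0 < ?B" using barrlund_denominator_pos[OF N(2)] .
  have u2: "(1 + a)\<^sup>2 \<le> (1 + u)\<^sup>2" "(1 + b)\<^sup>2 \<le> (1 + u)\<^sup>2" using u a b by (auto intro: power_mono)
  have "2 * A\<^sup>2 \<le> (1 + u)\<^sup>2 * ?B"
  proof (cases "b \<le> a")
    case True
    have "(1 + a)\<^sup>2 * ?B \<le> (1 + u)\<^sup>2 * ?B" using u2 B by (intro mult_right_mono) auto
    then show ?thesis using A_le_barrlund_aux[OF N True] by linarith
  next
    case False
    have "(1 + b)\<^sup>2 * ?B \<le> (1 + u)\<^sup>2 * ?B" using u2 B by (intro mult_right_mono) auto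
    moreover have "2 * A\<^sup>2 \<le> (1 + b)\<^sup>2 * (2 + b\<^sup>2 + a\<^sup>2 - 2 * N)"
      by (rule ball_triangle.A_le_barrlund_aux[OF swap]) (use N False in auto)
    ultimately show ?thesis by (simp add: add_ac)
  qed
  then have "(sqrt 2 * A)\<^sup>2 \<le> ((1 + u) * sqrt ?B)\<^sup>2"
    using B by (simp add: power_mult_distrib)
  then have "sqrt 2 * A \<le> (1 + u) * sqrt ?B" by (rule power2_le_imp_le) (use u a B in simp)
  then show ?thesis by (simp add: field_simps)
qed

end

section \<open>The metrics of the ball\<close>

lemma frontier_unit_ball: "frontier (ball 0 1 :: (real^'n) set) = sphere 0 1"
  by simp

lemma nearest_boundary_point:
  fixes x :: "real^'n"
  assumes "norm x < 1"
  obtains z where "norm z = 1" "dist x z = 1 - norm x"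
proof (cases "x = 0")
  case True
  then show ?thesis using that[of "axis undefined 1"] by simp
next
  case False
  have "x - x /\<^sub>R norm x = (1 - 1 / norm x) *\<^sub>R x" by (simp add: scaleR_diff_left divide_inverse)
  then have "dist x (x /\<^sub>R norm x) = \<bar>1 - 1 / norm x\<bar> * norm x" by (simp add: dist_norm)
  also have "\<dots> = \<bar>(1 - 1 / norm x) * norm x\<bar>" by (simp add: abs_mult)
  also have "(1 - 1 / norm x) * norm x = norm x - 1" using False by (simp add: left_diff_distrib)
  finally show ?thesis using that[of "x /\<^sub>R norm x"] False assms by simp
qed

lemma dG_unit_ball:
  fixes x :: "real^'n"
  assumes "norm x < 1"
  shows "dG (ball 0 1) x = 1 - norm x"
  unfolding dG_def frontier_unit_ball
proof (rule cInf_eq_minimum)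
  obtain z where "norm z = 1" "dist x z = 1 - norm x" using nearest_boundary_point[OF assms] .
  then show "1 - norm x \<in> dist x ` sphere 0 1" by (metis image_eqI mem_sphere_0)
  fix r assume "r \<in> dist x ` sphere 0 1"
  then obtain z where "norm z = 1" "r = dist x z" by auto
  then show "1 - norm x \<le> r" using norm_triangle_ineq2[of z x] by (simp add: dist_norm norm_minus_commute)
qed

text \<open>Reflecting \<open>y\<close> in the hyperplane tangent to the sphere at \<open>z\<close>.\<close>
lemma root_gaps_le_via_boundary:
  fixes x y z :: "'a::real_inner"
  assumes x: "norm x < 1" and y: "norm y < 1" and z: "norm z = 1"
  shows "sqrt ((dist x y)\<^sup>2 + 4 * (1 - norm x) * (1 - norm y)) \<le> dist x z + dist z y"
proof -
  define k where "k = 1 - y \<bullet> z"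
  define y' where "y' = y + (2 * k) *\<^sub>R z"
  have zz: "z \<bullet> z = 1" using z by (simp add: norm_eq_1)
  have "(norm (z - y'))\<^sup>2 = (norm (z - y))\<^sup>2"
    unfolding power2_norm_eq_inner y'_def
    by (simp add: inner_diff_left inner_diff_right inner_add_left inner_add_right inner_commute zz k_def algebra_simps)
  then have zy: "dist z y' = dist z y" by (simp add: dist_norm)
  have "(norm (x - y'))\<^sup>2 = (norm (x - y))\<^sup>2 + 4 * ((1 - x \<bullet> z) * k)"
    unfolding power2_norm_eq_inner y'_def
    by (simp add: inner_diff_left inner_diff_right inner_add_left inner_add_right inner_commute zz k_def algebra_simps)
  moreover have "(1 - norm x) * (1 - norm y) \<le> (1 - x \<bullet> z) * k"
    using norm_cauchy_schwarz[of x z] norm_cauchy_schwarz[of y z] x y z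
    unfolding k_def by (intro mult_mono) auto
  ultimately have "(dist x y)\<^sup>2 + 4 * (1 - norm x) * (1 - norm y) \<le> (dist x y')\<^sup>2"
    unfolding dist_norm mult.assoc by linarith
  then have "sqrt ((dist x y)\<^sup>2 + 4 * (1 - norm x) * (1 - norm y)) \<le> dist x y'"
    by (simp add: real_le_lsqrt)
  also have "\<dots> \<le> dist x z + dist z y" using dist_triangle[of x y' z] zy by simp
  finally show ?thesis .
qed

text \<open>The bounds are the denominators of \<open>p\<close> and \<open>j*\<close>. The upper one
  comes from testing the infimum at the boundary points nearest to \<open>x\<close> and to
  \<open>y\<close>.\<close>

lemma s_denominator_bounds:
  fixes x y :: "real^'n"
  assumes x: "norm x < 1" and y: "norm y < 1"
  defines "S \<equiv> INF z\<in>frontier (ball 0 1). dist x z + dist z y"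
  shows "sqrt ((dist x y)\<^sup>2 + 4 * (1 - norm x) * (1 - norm y)) \<le> S"
    "S \<le> dist x y + 2 * min (1 - norm x) (1 - norm y)"
proof -
  obtain u where u: "norm u = 1" "dist x u = 1 - norm x" using nearest_boundary_point[OF x] .
  obtain v where v: "norm v = 1" "dist y v = 1 - norm y" using nearest_boundary_point[OF y] .
  have bdd: "bdd_below ((\<lambda>z. dist x z + dist z y) ` sphere 0 1)"
    by (rule bdd_belowI[of _ 0]) auto
  show "sqrt ((dist x y)\<^sup>2 + 4 * (1 - norm x) * (1 - norm y)) \<le> S"
    unfolding S_def frontier_unit_ball using u(1)
    by (intro cINF_greatest root_gaps_le_via_boundary[OF x y]) auto
  have "S \<le> dist x u + dist u y" "S \<le> dist x v + dist v y"
    unfolding S_def frontier_unit_ball using u(1) v(1) by (auto intro!: cINF_lower[OF bdd])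
  moreover have "dist u y \<le> dist x u + dist x y" by (metis add.commute dist_commute dist_triangle)
  moreover have "dist x v \<le> dist x y + dist y v" by (rule dist_triangle)
  ultimately show "S \<le> dist x y + 2 * min (1 - norm x) (1 - norm y)"
    using u v by (auto simp: min_def dist_commute)
qed

text \<open>\<open>yt\<close> is the reflection of \<open>y\<close> in a nearest boundary point
  \<open>z\<close>, which satisfies \<open>y \<bullet> z = |y|\<close> even for
  \<open>y = 0\<close>. The lower bound is then Cauchy-Schwarz for \<open>x\<close> and
  \<open>y - z\<close>, a vector of length \<open>1 - |y|\<close>.\<close>

lemma dist_w_Xt_bounds:
  fixes x y :: "real^'n"
  assumes x: "norm x < 1" and y: "norm y < 1" and t: "yt \<in> w_Xt (ball 0 1) y"
  shows "sqrt ((dist x y)\<^sup>2 + 4 * (1 - norm x) * (1 - norm y)) \<le> dist x yt"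
    "dist x yt \<le> dist x y + 2 * (1 - norm y)"
proof -
  define z where "z = (y + yt) /\<^sub>R 2"
  have yt: "yt = 2 *\<^sub>R z - y" by (simp add: z_def)
  have z: "norm z = 1" and d: "dist y yt = 2 * (1 - norm y)"
    using t by (simp_all add: w_Xt_def dG_unit_ball[OF y] z_def)
  have "dist y yt = 2 * norm (y - z)"
  proof -
    have "y - yt = 2 *\<^sub>R (y - z)" by (simp add: yt scaleR_diff_right scaleR_2)
    then show ?thesis by (simp add: dist_norm)
  qed
  with d have yz: "norm (y - z) = 1 - norm y" by simp
  have zz: "z \<bullet> z = 1" using z by (simp add: norm_eq_1)
  have "(norm (y - z))\<^sup>2 = (norm y)\<^sup>2 - 2 * (y \<bullet> z) + 1"
    unfolding power2_norm_eq_inner by (simp add: inner_diff_left inner_diff_right inner_commute zz)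
  then have yz': "y \<bullet> z = norm y" unfolding yz by (simp add: power2_eq_square algebra_simps)
  have "- (norm x * (1 - norm y)) \<le> x \<bullet> (y - z)"
    using Cauchy_Schwarz_ineq2[of x "y - z"] yz by (simp add: abs_le_iff)
  then have cs: "(1 - norm x) * (1 - norm y) \<le> x \<bullet> y - x \<bullet> z - norm y + 1"
    by (simp add: inner_diff_right algebra_simps)
  have "(norm (x - yt))\<^sup>2 = (norm (x - y))\<^sup>2 + 4 * (x \<bullet> y - x \<bullet> z - y \<bullet> z + 1)"
    unfolding power2_norm_eq_inner yt
    by (simp add: inner_diff_left inner_diff_right inner_add_left inner_add_right inner_commute zz algebra_simps)
  moreover have "4 * ((1 - norm x) * (1 - norm y)) \<le> 4 * (x \<bullet> y - x \<bullet> z - y \<bullet> z + 1)"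
    using cs unfolding yz' by (rule mult_left_mono) simp
  ultimately have "(dist x y)\<^sup>2 + 4 * (1 - norm x) * (1 - norm y) \<le> (dist x yt)\<^sup>2"
    unfolding dist_norm mult.assoc by linarith
  then show "sqrt ((dist x y)\<^sup>2 + 4 * (1 - norm x) * (1 - norm y)) \<le> dist x yt"
    by (simp add: real_le_lsqrt)
  show "dist x yt \<le> dist x y + 2 * (1 - norm y)" using dist_triangle[of x yt y] d by simp
qed

lemma w_Xt_nonempty:
  fixes y :: "real^'n"
  assumes y: "norm y < 1"
  shows "w_Xt (ball 0 1) y \<noteq> {}"
proof -
  obtain z where z: "norm z = 1" "dist y z = 1 - norm y" using nearest_boundary_point[OF y] .
  have "y - (2 *\<^sub>R z - y) = 2 *\<^sub>R (y - z)" by (simp add: scaleR_diff_right scaleR_2)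
  then have "dist y (2 *\<^sub>R z - y) = 2 * (1 - norm y)" using z by (simp add: dist_norm)
  then have "2 *\<^sub>R z - y \<in> w_Xt (ball 0 1) y" using z by (simp add: w_Xt_def dG_unit_ball[OF y])
  then show ?thesis by blast
qed

lemma w_denominator_bounds:
  fixes x y :: "real^'n"
  assumes x: "norm x < 1" and y: "norm y < 1"
  defines "W \<equiv> min (INF yt\<in>w_Xt (ball 0 1) y. dist x yt) (INF xt\<in>w_Xt (ball 0 1) x. dist y xt)"
  shows "sqrt ((dist x y)\<^sup>2 + 4 * (1 - norm x) * (1 - norm y)) \<le> W"
    "W \<le> dist x y + 2 * min (1 - norm x) (1 - norm y)"
proof -
  have inf: "sqrt ((dist x y)\<^sup>2 + 4 * (1 - norm x) * (1 - norm y)) \<le> (INF yt\<in>w_Xt (ball 0 1) y. dist x yt)"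
    "(INF yt\<in>w_Xt (ball 0 1) y. dist x yt) \<le> dist x y + 2 * (1 - norm y)"
    if x: "norm x < 1" and y: "norm y < 1" for x y :: "real^'n"
  proof -
    show "sqrt ((dist x y)\<^sup>2 + 4 * (1 - norm x) * (1 - norm y)) \<le> (INF yt\<in>w_Xt (ball 0 1) y. dist x yt)"
      by (intro cINF_greatest w_Xt_nonempty[OF y] dist_w_Xt_bounds(1)[OF x y])
    obtain yt where yt: "yt \<in> w_Xt (ball 0 1) y" using w_Xt_nonempty[OF y] by blast
    have "bdd_below (dist x ` w_Xt (ball 0 1) y)" by (rule bdd_belowI[of _ 0]) auto
    then have "(INF yt\<in>w_Xt (ball 0 1) y. dist x yt) \<le> dist x yt" using yt by (rule cINF_lower)
    then show "(INF yt\<in>w_Xt (ball 0 1) y. dist x yt) \<le> dist x y + 2 * (1 - norm y)"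
      using dist_w_Xt_bounds(2)[OF x y yt] by linarith
  qed
  have sym: "4 * (1 - norm y) * (1 - norm x) = 4 * (1 - norm x) * (1 - norm y)" by (simp only: mult_ac)
  show "sqrt ((dist x y)\<^sup>2 + 4 * (1 - norm x) * (1 - norm y)) \<le> W"
    unfolding W_def using inf(1)[OF x y] inf(1)[OF y x] by (simp only: min.bounded_iff dist_commute[of y x] sym)
  show "W \<le> dist x y + 2 * min (1 - norm x) (1 - norm y)"
    unfolding W_def using inf(2)[OF x y] inf(2)[OF y x] by (simp add: min_def dist_commute)
qed

text \<open>On the unit sphere \<open>|x - z|^2 + |z - y|^2\<close> is affine in \<open>z\<close>
  and smallest in the direction of \<open>x + y\<close>, or at any point if
  \<open>x + y = 0\<close>.\<close>

lemma b_metric_unit_ball: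
  fixes x y :: "real^'n"
  assumes x: "norm x < 1" and y: "norm y < 1"
  shows "b_metric (ball 0 1) 2 x y = dist x y / sqrt (2 + (norm x)\<^sup>2 + (norm y)\<^sup>2 - 2 * norm (x + y))"
proof -
  let ?B = "2 + (norm x)\<^sup>2 + (norm y)\<^sup>2 - 2 * norm (x + y)"
  have B: "0 < ?B"
  proof -
    have "0 < (1 - norm x)\<^sup>2 + (1 - norm y)\<^sup>2" using x by (intro add_pos_nonneg) auto
    also have "\<dots> = 2 + (norm x)\<^sup>2 + (norm y)\<^sup>2 - 2 * (norm x + norm y)" by algebra
    finally have "0 < 2 + (norm x)\<^sup>2 + (norm y)\<^sup>2 - 2 * (norm x + norm y)" .
    moreover have "2 * norm (x + y) \<le> 2 * (norm x + norm y)" using norm_triangle_ineq[of x y] by simp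
    ultimately show ?thesis by linarith
  qed
  have val: "dist x y / ((dist x z powr 2 + dist z y powr 2) powr (1 / 2))
      = dist x y / sqrt (2 + (norm x)\<^sup>2 + (norm y)\<^sup>2 - 2 * (z \<bullet> (x + y)))" if z: "norm z = 1" for z
  proof -
    have zz: "z \<bullet> z = 1" using z by (simp add: norm_eq_1)
    have "(dist x z)\<^sup>2 + (dist z y)\<^sup>2 = 2 + (norm x)\<^sup>2 + (norm y)\<^sup>2 - 2 * (z \<bullet> (x + y))"
      unfolding dist_norm power2_norm_eq_inner
      by (simp add: inner_diff_left inner_diff_right inner_add_left inner_add_right inner_commute zz)
    moreover have "(dist x z powr 2 + dist z y powr 2) powr (1 / 2) = sqrt ((dist x z)\<^sup>2 + (dist z y)\<^sup>2)"
      by (simp add: powr_numeral powr_half_sqrt)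
    ultimately show ?thesis by simp
  qed
  show ?thesis
    unfolding b_metric_def frontier_unit_ball
  proof (rule cSup_eq_maximum)
    obtain z where z: "norm z = 1" "z \<bullet> (x + y) = norm (x + y)"
    proof (cases "x + y = 0")
      case True
      then show thesis using that[of "axis undefined 1"] by simp
    next
      case False
      have "((x + y) /\<^sub>R norm (x + y)) \<bullet> (x + y) = norm (x + y)"
        using False by (simp add: power2_norm_eq_inner[symmetric] power2_eq_square)
      then show thesis using that[of "(x + y) /\<^sub>R norm (x + y)"] False by simp
    qed
    have "dist x y / sqrt ?B = dist x y / ((dist x z powr 2 + dist z y powr 2) powr (1 / 2))"
      unfolding val[OF z(1)] z(2) ..
    then show "dist x y / sqrt ?B \<in> (\<lambda>z. dist x y / ((dist x z powr 2 + dist z y powr 2) powr (1 / 2))) ` sphere 0 1"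
      using z(1) by (metis (no_types, lifting) image_eqI mem_sphere_0)
  next
    fix r assume "r \<in> (\<lambda>z. dist x y / ((dist x z powr 2 + dist z y powr 2) powr (1 / 2))) ` sphere 0 1"
    then obtain z where z: "norm z = 1" "r = dist x y / ((dist x z powr 2 + dist z y powr 2) powr (1 / 2))" by auto
    have "z \<bullet> (x + y) \<le> norm (x + y)" using norm_cauchy_schwarz[of z "x + y"] z by simp
    then have "sqrt ?B \<le> sqrt (2 + (norm x)\<^sup>2 + (norm y)\<^sup>2 - 2 * (z \<bullet> (x + y)))" by simp
    then show "r \<le> dist x y / sqrt ?B"
      unfolding z(2) val[OF z(1)] using B by (intro divide_left_mono) auto
  qed
qed

text \<open>The Ahlfors bracket; its square also equals
  \<open>1 - 2 * (x \<bullet> y) + |x|^2 * |y|^2\<close>.\<close>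

definition hyp_norm :: "'a::euclidean_space \<Rightarrow> 'a \<Rightarrow> real" where
  "hyp_norm x y = sqrt ((dist x y)\<^sup>2 + (1 - (norm x)\<^sup>2) * (1 - (norm y)\<^sup>2))"

text \<open>This is \<open>tanh (\<rho> / 2)\<close> for the hyperbolic distance \<open>\<rho>\<close> of the ball.\<close>
definition hyp_tanh :: "'a::euclidean_space \<Rightarrow> 'a \<Rightarrow> real" where
  "hyp_tanh x y = dist x y / hyp_norm x y"

lemma ball_triangle_hyp_norm:
  fixes x y :: "'a::euclidean_space"
  assumes x: "norm x < 1" and y: "norm y < 1"
  shows "ball_triangle (norm x) (norm y) (dist x y) (hyp_norm x y)"
proof
  have "(norm x)\<^sup>2 < 1" "(norm y)\<^sup>2 < 1" using x y by (simp_all add: power_less_one_iff)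
  then have "0 \<le> (1 - (norm x)\<^sup>2) * (1 - (norm y)\<^sup>2)" by simp
  then show "(hyp_norm x y)\<^sup>2 = (dist x y)\<^sup>2 + (1 - (norm x)\<^sup>2) * (1 - (norm y)\<^sup>2)" "0 \<le> hyp_norm x y"
    by (simp_all add: hyp_norm_def)
  show "\<bar>norm x - norm y\<bar> \<le> dist x y" by (simp add: dist_norm norm_triangle_ineq3)
  show "dist x y \<le> norm x + norm y" by (simp add: dist_norm norm_triangle_ineq4)
qed (use x y in auto)

lemma hyp_tanh_eq_hyp_ratio:
  assumes x: "norm x < 1" and y: "norm y < 1"
  shows "hyp_tanh x y = sqrt (hyp_ratio x y / (1 + hyp_ratio x y))"
proof -
  have "(norm x)\<^sup>2 < 1" "(norm y)\<^sup>2 < 1" using x y by (simp_all add: power_less_one_iff)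
  then have C: "0 < (1 - (norm x)\<^sup>2) * (1 - (norm y)\<^sup>2)" by simp
  define C where "C = (1 - (norm x)\<^sup>2) * (1 - (norm y)\<^sup>2)"
  have "0 \<le> (dist x y)\<^sup>2" by simp
  then have "hyp_ratio x y / (1 + hyp_ratio x y) = (dist x y)\<^sup>2 / ((dist x y)\<^sup>2 + C)"
    using C unfolding hyp_ratio_def C_def[symmetric] by (simp add: field_simps)
  then show ?thesis by (simp add: hyp_tanh_def hyp_norm_def C_def real_sqrt_divide)
qed

section \<open>Comparison with the invariant and the final quotients\<close>

lemma quotient_sandwich:
  fixes d a s :: real
  assumes "0 < d" "0 < a" "0 < s" "c1 * s \<le> a" "a \<le> c2 * s"
  shows "c1 * (d / a) \<le> d / s \<and> d / s \<le> c2 * (d / a)"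
proof -
  have "d * (c1 * s) \<le> d * a" "d * a \<le> d * (c2 * s)" using assms by simp_all
  then show ?thesis using assms by (simp add: field_simps)
qed

lemma unit_ball_metric_bounds:
  fixes x y :: "real^'n"
  assumes xy: "norm x < 1" "norm y < 1" "x \<noteq> y" and l: "0 \<le> l" "l \<le> norm x" "l \<le> norm y"
    and u: "u < 1" "norm x \<le> u" "norm y \<le> u"
  defines "T \<equiv> hyp_tanh x y"
  shows "0 < T"
    "1 / 2 * T \<le> t_metric (ball 0 1) x y \<and> t_metric (ball 0 1) x y \<le> (1 + u) / 2 * T"
    "(1 + l) / sqrt (5 + 2 * l + l\<^sup>2) * T \<le> jstar_metric (ball 0 1) x y \<and>
      jstar_metric (ball 0 1) x y \<le> (1 + u) / 2 * T"
    "(1 + l) / 2 * T \<le> p_metric (ball 0 1) x y \<and>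
      p_metric (ball 0 1) x y \<le> (1 + u\<^sup>2) / (2 * sqrt (1 - 2 * u + 2 * u\<^sup>2)) * T"
    "sqrt (1 + l\<^sup>2) / sqrt 2 * T \<le> b_metric (ball 0 1) 2 x y \<and>
      b_metric (ball 0 1) 2 x y \<le> (1 + u) / sqrt 2 * T"
    "(1 + l) / sqrt (5 + 2 * l + l\<^sup>2) * T \<le> s_metric (ball 0 1) x y \<and>
      s_metric (ball 0 1) x y \<le> (1 + u\<^sup>2) / (2 * sqrt (1 - 2 * u + 2 * u\<^sup>2)) * T"
    "(1 + l) / sqrt (5 + 2 * l + l\<^sup>2) * T \<le> w_metric (ball 0 1) x y \<and>
      w_metric (ball 0 1) x y \<le> (1 + u\<^sup>2) / (2 * sqrt (1 - 2 * u + 2 * u\<^sup>2)) * T"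
proof -
  interpret ball_triangle "norm x" "norm y" "dist x y" "hyp_norm x y"
    by (rule ball_triangle_hyp_norm[OF xy(1,2)])
  have D: "0 < dist x y" using xy by simp
  note dG = dG_unit_ball[OF xy(1)] dG_unit_ball[OF xy(2)]
  note sandwich = quotient_sandwich[OF D A_pos, folded hyp_tanh_def, folded T_def]
  show "0 < T" unfolding T_def hyp_tanh_def using D A_pos by simp
  show "1 / 2 * T \<le> t_metric (ball 0 1) x y \<and> t_metric (ball 0 1) x y \<le> (1 + u) / 2 * T"
    unfolding t_metric_def dG
  proof (rule sandwich)
    show "0 < dist x y + (1 - norm x) + (1 - norm y)" using D xy by linarith
    show "1 / 2 * (dist x y + (1 - norm x) + (1 - norm y)) \<le> hyp_norm x y" using D_plus_gaps_le by simp
    show "hyp_norm x y \<le> (1 + u) / 2 * (dist x y + (1 - norm x) + (1 - norm y))" by (rule A_le_gaps[OF u(2,3)])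
  qed
  have Jpos: "0 < dist x y + 2 * min (1 - norm x) (1 - norm y)" using D xy by (intro add_pos_nonneg) auto
  show "(1 + l) / sqrt (5 + 2 * l + l\<^sup>2) * T \<le> jstar_metric (ball 0 1) x y \<and>
      jstar_metric (ball 0 1) x y \<le> (1 + u) / 2 * T"
    unfolding jstar_metric_def dG by (rule sandwich[OF Jpos min_gap_le_A[OF l] A_le_min_gap[OF u(2,3)]])
  have Ppos: "0 < sqrt ((dist x y)\<^sup>2 + 4 * (1 - norm x) * (1 - norm y))"
    using D xy by (simp add: add_pos_nonneg)
  note P = A_le_root_gaps[OF u(2,3,1)]
  show "(1 + l) / 2 * T \<le> p_metric (ball 0 1) x y \<and>
      p_metric (ball 0 1) x y \<le> (1 + u\<^sup>2) / (2 * sqrt (1 - 2 * u + 2 * u\<^sup>2)) * T"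
    unfolding p_metric_def dG by (rule sandwich[OF Ppos root_gaps_le_A[OF l] P])
  have N: "0 \<le> norm (x + y)" "norm (x + y) \<le> norm x + norm y"
    "(norm (x + y))\<^sup>2 = 2 * (norm x)\<^sup>2 + 2 * (norm y)\<^sup>2 - (dist x y)\<^sup>2"
    by (simp_all add: norm_triangle_ineq dist_norm power2_norm_eq_inner inner_add_left inner_add_right inner_diff_left inner_diff_right inner_commute)
  show "sqrt (1 + l\<^sup>2) / sqrt 2 * T \<le> b_metric (ball 0 1) 2 x y \<and>
      b_metric (ball 0 1) 2 x y \<le> (1 + u) / sqrt 2 * T"
    unfolding b_metric_unit_ball[OF xy(1,2)]
    by (rule sandwich[OF _ barrlund_le_A[OF N l] A_le_barrlund[OF N u(2,3)]])
      (rule real_sqrt_gt_zero[OF barrlund_denominator_pos[OF N(2)]])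
  \<comment> \<open>Serves \<open>s\<close> and \<open>w\<close> alike: it covers every denominator
    lying between those of \<open>p\<close> and \<open>j*\<close>.\<close>
  have between: "(1 + l) / sqrt (5 + 2 * l + l\<^sup>2) * T \<le> dist x y / S \<and>
      dist x y / S \<le> (1 + u\<^sup>2) / (2 * sqrt (1 - 2 * u + 2 * u\<^sup>2)) * T"
    if S: "sqrt ((dist x y)\<^sup>2 + 4 * (1 - norm x) * (1 - norm y)) \<le> S"
      "S \<le> dist x y + 2 * min (1 - norm x) (1 - norm y)" for S
  proof (rule sandwich)
    show "0 < S" using Ppos S(1) by linarith
    have "0 \<le> (1 + l) / sqrt (5 + 2 * l + l\<^sup>2)" using l by simp
    then have "(1 + l) / sqrt (5 + 2 * l + l\<^sup>2) * S
        \<le> (1 + l) / sqrt (5 + 2 * l + l\<^sup>2) * (dist x y + 2 * min (1 - norm x) (1 - norm y))"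
      by (rule mult_left_mono[OF S(2)])
    then show "(1 + l) / sqrt (5 + 2 * l + l\<^sup>2) * S \<le> hyp_norm x y" using min_gap_le_A[OF l] by linarith
    have "0 \<le> (1 + u\<^sup>2) / (2 * sqrt (1 - 2 * u + 2 * u\<^sup>2))" using quadratic_pos[OF u(1)] by simp
    then have "(1 + u\<^sup>2) / (2 * sqrt (1 - 2 * u + 2 * u\<^sup>2)) * sqrt ((dist x y)\<^sup>2 + 4 * (1 - norm x) * (1 - norm y))
        \<le> (1 + u\<^sup>2) / (2 * sqrt (1 - 2 * u + 2 * u\<^sup>2)) * S"
      by (rule mult_left_mono[OF S(1)])
    then show "hyp_norm x y \<le> (1 + u\<^sup>2) / (2 * sqrt (1 - 2 * u + 2 * u\<^sup>2)) * S" using P by linarith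
  qed
  show "(1 + l) / sqrt (5 + 2 * l + l\<^sup>2) * T \<le> s_metric (ball 0 1) x y \<and>
      s_metric (ball 0 1) x y \<le> (1 + u\<^sup>2) / (2 * sqrt (1 - 2 * u + 2 * u\<^sup>2)) * T"
    unfolding s_metric_def by (rule between[OF s_denominator_bounds[OF xy(1,2)]])
  show "(1 + l) / sqrt (5 + 2 * l + l\<^sup>2) * T \<le> w_metric (ball 0 1) x y \<and>
      w_metric (ball 0 1) x y \<le> (1 + u\<^sup>2) / (2 * sqrt (1 - 2 * u + 2 * u\<^sup>2)) * T"
    unfolding w_metric_def by (rule between[OF w_denominator_bounds[OF xy(1,2)]])
qed

lemma ratio_between:
  fixes T m m' :: real
  assumes T: "0 < T" and m: "c1 * T \<le> m" "m \<le> c2 * T" and m': "d1 * T \<le> m'" "m' \<le> d2 * T"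
    and c1: "0 < c1" and d1: "0 \<le> d1"
  shows "d1 / c2 \<le> m' / m" "m' / m \<le> d2 / c1"
proof -
  have mp: "0 < m" using m(1) T c1 by (meson less_le_trans mult_pos_pos)
  have "0 \<le> d1 * T" using d1 T by simp
  then have m'0: "0 \<le> m'" using m'(1) by (rule order_trans)
  have "d1 / c2 = (d1 * T) / (c2 * T)" using T by simp
  also have "\<dots> \<le> m' / m" using m' m mp m'0 by (intro frac_le) auto
  finally show "d1 / c2 \<le> m' / m" .
  have "m' / m \<le> (d2 * T) / (c1 * T)" using m' m mp m'0 c1 T by (intro frac_le) auto
  also have "\<dots> = d2 / c1" using T by simp
  finally show "m' / m \<le> d2 / c1" .
qed

theorem theorem4p7:
  fixes f :: "real^'n \<Rightarrow> real^'n" and x y :: "real^'n"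
    and rl ru Rl Ru :: real
  assumes "CARD('n) \<ge> 2"
    and "conformal_map (ball 0 1) (ball 0 1) f"
    and "x \<in> ball 0 1" "y \<in> ball 0 1" "x \<noteq> y"
    and "0 \<le> rl" "rl < 1" "0 \<le> ru" "ru < 1" "0 \<le> Rl" "Rl < 1" "0 \<le> Ru" "Ru < 1"
    and "rl \<le> norm x" "norm x \<le> ru" "rl \<le> norm y" "norm y \<le> ru"
    and "Rl \<le> norm (f x)" "norm (f x) \<le> Ru" "Rl \<le> norm (f y)" "norm (f y) \<le> Ru"
  shows
    "1 / (1 + ru) \<le> t_metric (ball 0 1) (f x) (f y) / t_metric (ball 0 1) x y \<and>
     t_metric (ball 0 1) (f x) (f y) / t_metric (ball 0 1) x y \<le> 1 + Ru \<and>

     2 * (1 + Rl) / ((1 + ru) * sqrt (5 + 2 * Rl + Rl\<^sup>2))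
       \<le> jstar_metric (ball 0 1) (f x) (f y) / jstar_metric (ball 0 1) x y \<and>
     jstar_metric (ball 0 1) (f x) (f y) / jstar_metric (ball 0 1) x y
       \<le> (1 + Ru) * sqrt (5 + 2 * rl + rl\<^sup>2) / (2 * (1 + rl)) \<and>

     sqrt (1 - 2 * ru + 2 * ru\<^sup>2) * (1 + Rl) / (1 + ru\<^sup>2)
       \<le> p_metric (ball 0 1) (f x) (f y) / p_metric (ball 0 1) x y \<and>
     p_metric (ball 0 1) (f x) (f y) / p_metric (ball 0 1) x y
       \<le> (1 + Ru\<^sup>2) / ((1 + rl) * sqrt (1 - 2 * Ru + 2 * Ru\<^sup>2)) \<and>

     sqrt (1 + Rl\<^sup>2) / (1 + ru)
       \<le> b_metric (ball 0 1) 2 (f x) (f y) / b_metric (ball 0 1) 2 x y \<and>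
     b_metric (ball 0 1) 2 (f x) (f y) / b_metric (ball 0 1) 2 x y
       \<le> (1 + Ru) / sqrt (1 + rl\<^sup>2) \<and>

     2 * (1 + Rl) * sqrt (1 - 2 * ru + 2 * ru\<^sup>2) / ((1 + ru\<^sup>2) * sqrt (5 + 2 * Rl + Rl\<^sup>2))
       \<le> s_metric (ball 0 1) (f x) (f y) / s_metric (ball 0 1) x y \<and>
     s_metric (ball 0 1) (f x) (f y) / s_metric (ball 0 1) x y
       \<le> (1 + Ru\<^sup>2) * sqrt (5 + 2 * rl + rl\<^sup>2) / (2 * (1 + rl) * sqrt (1 - 2 * Ru + 2 * Ru\<^sup>2)) \<and>

     2 * (1 + Rl) * sqrt (1 - 2 * ru + 2 * ru\<^sup>2) / ((1 + ru\<^sup>2) * sqrt (5 + 2 * Rl + Rl\<^sup>2))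
       \<le> w_metric (ball 0 1) (f x) (f y) / w_metric (ball 0 1) x y \<and>
     w_metric (ball 0 1) (f x) (f y) / w_metric (ball 0 1) x y
       \<le> (1 + Ru\<^sup>2) * sqrt (5 + 2 * rl + rl\<^sup>2) / (2 * (1 + rl) * sqrt (1 - 2 * Ru + 2 * Ru\<^sup>2))"
proof -
  obtain g L where c: "ball_conf f g L" using conformal_map_imp_ball_conf[OF assms(2)] .
  have x: "norm x < 1" and y: "norm y < 1" using assms by auto
  have fx: "norm (f x) < 1" and fy: "norm (f y) < 1" using ball_confD(1)[OF c] x y by auto
  have ne: "f x \<noteq> f y" using ball_confD(3)[OF c] x y \<open>x \<noteq> y\<close> by metis
  \<comment> \<open>The invariance of the hyperbolic distance: both pairs are compared with the same
    number, which cancels in every quotient.\<close>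
  have T: "hyp_tanh (f x) (f y) = hyp_tanh x y"
    using ball_conf_hyp_ratio[OF c assms(1) x y] by (simp add: hyp_tanh_eq_hyp_ratio x y fx fy)
  note B = unit_ball_metric_bounds[OF x y \<open>x \<noteq> y\<close> \<open>0 \<le> rl\<close> \<open>rl \<le> norm x\<close> \<open>rl \<le> norm y\<close> \<open>ru < 1\<close> \<open>norm x \<le> ru\<close> \<open>norm y \<le> ru\<close>]
  note B' = unit_ball_metric_bounds[OF fx fy ne \<open>0 \<le> Rl\<close> \<open>Rl \<le> norm (f x)\<close> \<open>Rl \<le> norm (f y)\<close> \<open>Ru < 1\<close> \<open>norm (f x) \<le> Ru\<close> \<open>norm (f y) \<le> Ru\<close>,
      unfolded T]
  note R = ratio_between[OF B(1)]
  have r5: "0 < sqrt (5 + 2 * r + r\<^sup>2)" if "0 \<le> r" for r :: real using that by (simp add: add_pos_nonneg)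
  have pos: "0 < (1 + rl) / sqrt (5 + 2 * rl + rl\<^sup>2)" "0 \<le> (1 + Rl) / sqrt (5 + 2 * Rl + Rl\<^sup>2)"
    "0 < (1 + rl) / 2" "0 \<le> (1 + Rl) / 2" "0 < sqrt (1 + rl\<^sup>2) / sqrt 2" "0 \<le> sqrt (1 + Rl\<^sup>2) / sqrt 2"
    using r5[OF \<open>0 \<le> rl\<close>] r5[OF \<open>0 \<le> Rl\<close>] \<open>0 \<le> rl\<close> \<open>0 \<le> Rl\<close> by (simp_all add: add_pos_nonneg)
  have t: "1 / (1 + ru) \<le> t_metric (ball 0 1) (f x) (f y) / t_metric (ball 0 1) x y"
    "t_metric (ball 0 1) (f x) (f y) / t_metric (ball 0 1) x y \<le> 1 + Ru"
  proof -
    have "1 / 2 / ((1 + ru) / 2) = 1 / (1 + ru)" "(1 + Ru) / 2 / (1 / 2) = 1 + Ru" by simp_all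
    note t = R[OF B(2)[THEN conjunct1] B(2)[THEN conjunct2] B'(2)[THEN conjunct1] B'(2)[THEN conjunct2] half_gt_zero[OF zero_less_one]
        less_imp_le[OF half_gt_zero[OF zero_less_one]], unfolded this]
    show "1 / (1 + ru) \<le> t_metric (ball 0 1) (f x) (f y) / t_metric (ball 0 1) x y"
      "t_metric (ball 0 1) (f x) (f y) / t_metric (ball 0 1) x y \<le> 1 + Ru" by (fact t)+
  qed
  note j = R[OF B(3)[THEN conjunct1] B(3)[THEN conjunct2] B'(3)[THEN conjunct1] B'(3)[THEN conjunct2] pos(1,2)]
  note p = R[OF B(4)[THEN conjunct1] B(4)[THEN conjunct2] B'(4)[THEN conjunct1] B'(4)[THEN conjunct2] pos(3,4)]
  note b = R[OF B(5)[THEN conjunct1] B(5)[THEN conjunct2] B'(5)[THEN conjunct1] B'(5)[THEN conjunct2] pos(5,6)]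
  note s = R[OF B(6)[THEN conjunct1] B(6)[THEN conjunct2] B'(6)[THEN conjunct1] B'(6)[THEN conjunct2] pos(1,2)]
  note w = R[OF B(7)[THEN conjunct1] B(7)[THEN conjunct2] B'(7)[THEN conjunct1] B'(7)[THEN conjunct2] pos(1,2)]
  have j1: "(1 + Rl) / sqrt (5 + 2 * Rl + Rl\<^sup>2) / ((1 + ru) / 2) = 2 * (1 + Rl) / ((1 + ru) * sqrt (5 + 2 * Rl + Rl\<^sup>2))"
    and j2: "(1 + Ru) / 2 / ((1 + rl) / sqrt (5 + 2 * rl + rl\<^sup>2)) = (1 + Ru) * sqrt (5 + 2 * rl + rl\<^sup>2) / (2 * (1 + rl))"
    and p1: "(1 + Rl) / 2 / ((1 + ru\<^sup>2) / (2 * sqrt (1 - 2 * ru + 2 * ru\<^sup>2))) = sqrt (1 - 2 * ru + 2 * ru\<^sup>2) * (1 + Rl) / (1 + ru\<^sup>2)"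
    and p2: "(1 + Ru\<^sup>2) / (2 * sqrt (1 - 2 * Ru + 2 * Ru\<^sup>2)) / ((1 + rl) / 2) = (1 + Ru\<^sup>2) / ((1 + rl) * sqrt (1 - 2 * Ru + 2 * Ru\<^sup>2))"
    and b1: "sqrt (1 + Rl\<^sup>2) / sqrt 2 / ((1 + ru) / sqrt 2) = sqrt (1 + Rl\<^sup>2) / (1 + ru)"
    and b2: "(1 + Ru) / sqrt 2 / (sqrt (1 + rl\<^sup>2) / sqrt 2) = (1 + Ru) / sqrt (1 + rl\<^sup>2)"
    and s1: "(1 + Rl) / sqrt (5 + 2 * Rl + Rl\<^sup>2) / ((1 + ru\<^sup>2) / (2 * sqrt (1 - 2 * ru + 2 * ru\<^sup>2)))
      = 2 * (1 + Rl) * sqrt (1 - 2 * ru + 2 * ru\<^sup>2) / ((1 + ru\<^sup>2) * sqrt (5 + 2 * Rl + Rl\<^sup>2))"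
    and s2: "(1 + Ru\<^sup>2) / (2 * sqrt (1 - 2 * Ru + 2 * Ru\<^sup>2)) / ((1 + rl) / sqrt (5 + 2 * rl + rl\<^sup>2))
      = (1 + Ru\<^sup>2) * sqrt (5 + 2 * rl + rl\<^sup>2) / (2 * (1 + rl) * sqrt (1 - 2 * Ru + 2 * Ru\<^sup>2))"
    by (simp_all only: divide_divide_eq_left divide_divide_eq_right times_divide_eq_left times_divide_eq_right mult_ac)
      (simp_all add: divide_simps)
  show ?thesis
    using t j[unfolded j1 j2] p[unfolded p1 p2] b[unfolded b1 b2] s[unfolded s1 s2] w[unfolded s1 s2] by (intro conjI)
qed

end
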